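(* Let $p>2$. Then $f_p'(0)=\lim_{r\to0^+}\frac{f_p(r)}{r}$ exists and is a positive number.
   Context: For $p>2$, $$X_p=\Big\{f\in W^{1,p}_{\mathrm{loc}}(0,\infty):\ \int_0^\infty\big(|f'|^2+\tfrac{f^2}{r^2}\big)^{p/2}\,r\,dr<\infty\Big\}$$ (real-valued functions; every $f\in X_p$ has a continuous representative on $[0,\infty)$ with $f(0)=0$), and $$I_p(f)=\int_0^\infty\Big\{\Big[(f')^2+\frac{f^2}{r^2}\Big]^{p/2}+\frac12(1-f^2)^2\Big\}\,r\,dr.$$ $f_p$ denotes the unique non-negative minimizer of $I_p$ over $X_p$. *)

theory Defs
  imports "HOL-Analysis.Analysis"
begin

text \<open>Functions on the half-line are total functions on the reals of which only the values on
  \<open>{0<..}\<close> matter (\<open>{0..}\<close> for continuous representatives). Classes of functions modulo null sets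
  are represented by Borel functions.\<close>

definition Lp_loc :: "real \<Rightarrow> (real \<Rightarrow> real) \<Rightarrow> bool" where
  "Lp_loc p u \<longleftrightarrow> set_borel_measurable lborel {0<..} u \<and>
     (\<forall>a b. 0 < a \<longrightarrow> a < b \<longrightarrow> set_integrable lborel {a..b} (\<lambda>r. \<bar>u r\<bar> powr p))"

text \<open>\<open>C_c^\<infinity>(0,\<infinity>)\<close>, each function being extended by zero to the real line.\<close>

definition test_function :: "(real \<Rightarrow> real) \<Rightarrow> bool" where
  "test_function \<phi> \<longleftrightarrow> (\<forall>n x. ((deriv ^^ n) \<phi>) differentiable (at x)) \<and>
     (\<exists>a b. 0 < a \<and> a < b \<and> (\<forall>x. x \<notin> {a..b} \<longrightarrow> \<phi> x = 0))"

definition has_weak_deriv :: "(real \<Rightarrow> real) \<Rightarrow> (real \<Rightarrow> real) \<Rightarrow> bool" where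
  "has_weak_deriv u v \<longleftrightarrow> Lp_loc 1 u \<and> Lp_loc 1 v \<and>
     (\<forall>\<phi>. test_function \<phi> \<longrightarrow>
        (LINT r:{0<..}|lborel. u r * deriv \<phi> r) = - (LINT r:{0<..}|lborel. v r * \<phi> r))"

text \<open>Unique up to null sets when it exists, so integrals do not depend on the choice.\<close>

definition weak_deriv :: "(real \<Rightarrow> real) \<Rightarrow> real \<Rightarrow> real" where
  "weak_deriv u = (SOME v. has_weak_deriv u v)"

definition W1p_loc :: "real \<Rightarrow> (real \<Rightarrow> real) set" where
  "W1p_loc p = {u. Lp_loc p u \<and> (\<exists>v. has_weak_deriv u v \<and> Lp_loc p v)}"

definition X_space :: "real \<Rightarrow> (real \<Rightarrow> real) set" where
  "X_space p = {f \<in> W1p_loc p.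
     (\<integral>\<^sup>+ r\<in>{0<..}. ennreal ((\<bar>weak_deriv f r\<bar>\<^sup>2 + (f r)\<^sup>2 / r\<^sup>2) powr (p / 2) * r) \<partial>lborel) < \<infinity>}"

text \<open>Extended-valued: the potential term may be infinite on \<open>X_space p\<close>.\<close>

definition I_energy :: "real \<Rightarrow> (real \<Rightarrow> real) \<Rightarrow> ennreal" where
  "I_energy p f =
     (\<integral>\<^sup>+ r\<in>{0<..}. ennreal ((((weak_deriv f r)\<^sup>2 + (f r)\<^sup>2 / r\<^sup>2) powr (p / 2)
                            + 1 / 2 * (1 - (f r)\<^sup>2)\<^sup>2) * r) \<partial>lborel)"

definition is_minimizer :: "real \<Rightarrow> (real \<Rightarrow> real) \<Rightarrow> bool" where
  "is_minimizer p f \<longleftrightarrow> f \<in> X_space p \<and> (\<forall>g \<in> X_space p. I_energy p f \<le> I_energy p g)"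

text \<open>The function \<open>f\<close> is the continuous representative on \<open>{0..}\<close> of a non-negative minimizer.
  The value \<open>f 0 = 0\<close> is not imposed: it follows from continuity and \<open>f \<in> X_space p\<close>
  when \<open>p > 2\<close>.\<close>

definition nonneg_minimizer :: "real \<Rightarrow> (real \<Rightarrow> real) \<Rightarrow> bool" where
  "nonneg_minimizer p f \<longleftrightarrow>
     is_minimizer p f \<and> continuous_on {0..} f \<and> (\<forall>r\<ge>0. 0 \<le> f r)"

end

theory Submission
  imports Defs
begin

text \<open>Everything is a comparison with one competitor. For \<open>R > 0\<close> replace a minimizer \<open>f\<close> on
  \<open>(0, R)\<close> by the chord \<open>a r\<close>, \<open>a = f(R)/R\<close>. The map \<open>a r e\<^sup>i\<^sup>\<theta>\<close> is \<open>p\<close>-harmonic, so the first-order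
  difference of the gradient terms integrates to zero, and uniform convexity gives
  \<open>c \<integral>\<^sub>0\<^sup>R \<bar>f' - a\<bar>\<^sup>p r dr \<le> \<integral>\<^sub>0\<^sup>R \<onehalf>((1 - a\<^sup>2r\<^sup>2)\<^sup>2 - (1 - f\<^sup>2)\<^sup>2) r dr\<close>.

  Bounding the right-hand side by \<open>C R\<^sup>2 sup f\<^sup>2\<close> makes \<open>f(r)/r\<close> oscillate by at most
  \<open>C (sup f)\<^bsup>2/p\<^esup>\<close> on \<open>[R/2, R]\<close>. With \<open>f\<close> merely bounded this yields \<open>f(r) \<le> M r\<^bsup>1/2\<^esup>\<close>; used again,
  the oscillation is \<open>O(R\<^bsup>1/p\<^esup>)\<close>, so it is summable over dyadic scales and \<open>f(r)/r\<close> converges.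

  If the limit were \<open>0\<close>, take the first \<open>b\<close> at which \<open>f(r)/r\<close> reaches a small level \<open>t > 0\<close>.
  Then \<open>f < t r \<le> 1\<close> on \<open>(0, b)\<close>, and for \<open>R = b\<close> the right-hand side is negative.\<close>

section \<open>Smooth cutoff functions\<close>

text \<open>Only energies are compared: no Euler-Lagrange equation is derived, and local absolute
  continuity is all the regularity used. The obstacle is the definition of the energy, which takes
  an arbitrary choice of weak derivative, specified by testing with smooth compactly supported
  functions. Hence the relation \<open>primitive\<close>: a continuous function with a weak
  derivative is an integral of it, and a function glued from two pieces has the expected weak
  derivative almost everywhere. The first fact needs test functions close to indicators of
  intervals, so explicit smooth cutoffs are built.

  The exponent 2/p comes from an average: with B = sup f the excess over (0, R) is O(R^2 B^2), so
  |f' - a|^p has weighted mean O(B^2). Two passes are needed because a constant B costs the slope a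
  constant amount per dyadic scale. This is not summable and only gives a logarithmic bound for
  f(r)/r; but any bound f(r) = O(r^\<alpha>) with 0 < \<alpha> < 1 would feed the second
  pass.\<close>

definition exp_bump :: "nat \<Rightarrow> real \<Rightarrow> real" where
  "exp_bump k x = (if x > 0 then (1 / x) ^ k * exp (- (1 / x)) else 0)"

text \<open>\<open>test_function\<close> asks that every iterate of \<open>deriv\<close> be
  differentiable. A class of expressions closed under differentiation gives this at once. The bumps
  carry a power \<open>k\<close> for that purpose: differentiating x^(-k) e^(-1/x) yields a
  combination of the bumps with \<open>k + 1\<close> and \<open>k + 2\<close>.\<close>

inductive smooth_expr :: "(real \<Rightarrow> real) \<Rightarrow> bool" where
  ident: "smooth_expr (\<lambda>x. x)"
| const: "smooth_expr (\<lambda>x. c)"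
| bump: "smooth_expr (exp_bump k)"
| add: "smooth_expr f \<Longrightarrow> smooth_expr g \<Longrightarrow> smooth_expr (\<lambda>x. f x + g x)"
| mult: "smooth_expr f \<Longrightarrow> smooth_expr g \<Longrightarrow> smooth_expr (\<lambda>x. f x * g x)"
| inverse: "smooth_expr f \<Longrightarrow> (\<And>x. f x \<noteq> 0) \<Longrightarrow> smooth_expr (\<lambda>x. inverse (f x))"
| compose: "smooth_expr f \<Longrightarrow> smooth_expr g \<Longrightarrow> smooth_expr (\<lambda>x. f (g x))"

lemma exp_bump_tendsto_0: "(exp_bump k \<longlongrightarrow> 0) (at 0)"
proof -
  have "((\<lambda>x::real. (1 / x) ^ k / exp (1 / x)) \<longlongrightarrow> 0) (at_right 0)"
    using filterlim_compose[OF tendsto_power_div_exp_0 filterlim_inverse_at_top_right, of k]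
    by (simp add: inverse_eq_divide)
  then have "(exp_bump k \<longlongrightarrow> 0) (at_right 0)"
    by (rule Lim_transform_eventually)
       (auto simp: eventually_at_right_less exp_bump_def exp_minus field_simps
             intro!: eventually_mono[OF eventually_at_right_less])
  moreover have "(exp_bump k \<longlongrightarrow> 0) (at_left 0)"
    by (rule tendsto_eventually)
       (auto simp: exp_bump_def eventually_at intro!: exI[of _ 1])
  ultimately show ?thesis by (simp add: filterlim_split_at)
qed

lemma exp_bump_has_derivative:
  "(exp_bump k has_real_derivative exp_bump (k + 2) x - real k * exp_bump (k + 1) x) (at x)"
proof -
  consider "x > 0" | "x < 0" | "x = 0" by linarith
  then show ?thesis
  proof cases
    case 1
    have inv: "((\<lambda>x. 1 / x) has_real_derivative - ((1 / x)\<^sup>2)) (at x)"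
      using 1 by (auto intro!: derivative_eq_intros simp: power2_eq_square)
    have "((\<lambda>x. (1 / x) ^ k * exp (- (1 / x))) has_real_derivative
        real k * (- ((1 / x)\<^sup>2) * (1 / x) ^ (k - Suc 0)) * exp (- (1 / x)) +
        exp (- (1 / x)) * - (- ((1 / x)\<^sup>2)) * (1 / x) ^ k) (at x)"
      by (intro DERIV_mult DERIV_power DERIV_fun_exp DERIV_minus inv)
    moreover have "real k * (- ((1 / x)\<^sup>2) * (1 / x) ^ (k - Suc 0)) * exp (- (1 / x)) +
        exp (- (1 / x)) * - (- ((1 / x)\<^sup>2)) * (1 / x) ^ k =
        exp_bump (k + 2) x - real k * exp_bump (k + 1) x"
      using 1 by (cases k) (simp_all add: exp_bump_def power_add power2_eq_square algebra_simps)
    ultimately have "((\<lambda>x. (1 / x) ^ k * exp (- (1 / x))) has_real_derivative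
        exp_bump (k + 2) x - real k * exp_bump (k + 1) x) (at x)"
      by (simp only:)
    then show ?thesis
      by (rule has_field_derivative_transform_within_open[where S = "{0<..}"])
         (use 1 in \<open>auto simp: exp_bump_def\<close>)
  next
    case 2
    have "((\<lambda>x. 0) has_real_derivative exp_bump (k + 2) x - real k * exp_bump (k + 1) x) (at x)"
      using 2 by (simp add: exp_bump_def)
    then show ?thesis
      by (rule has_field_derivative_transform_within_open[where S = "{..<0}"])
         (use 2 in \<open>auto simp: exp_bump_def\<close>)
  next
    case 3
    \<comment> \<open>At the origin the difference quotient is itself a bump, with one more power of
      1/y, and so tends to 0. The identity also holds at \<open>y = 0\<close>, where both sides are
      0.\<close>
    have "exp_bump k y / y = exp_bump (k + 1) y" for y
      by (simp add: exp_bump_def field_simps)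
    then have "((\<lambda>y. (exp_bump k y - exp_bump k 0) / (y - 0)) \<longlongrightarrow> 0) (at 0)"
      using exp_bump_tendsto_0[of "k + 1"] by (simp add: exp_bump_def[of _ 0])
    then show ?thesis
      using 3 by (simp add: has_field_derivative_iff exp_bump_def[of _ 0])
  qed
qed

lemma smooth_expr_deriv:
  assumes "smooth_expr f"
  shows "smooth_expr (deriv f) \<and> (\<forall>x. f differentiable at x)"
proof -
  \<comment> \<open>The induction produces some derivative inside the class; it is identified with
    \<open>deriv f\<close> only afterwards.\<close>
  have "\<exists>f'. smooth_expr f' \<and> (\<forall>x. (f has_real_derivative f' x) (at x))"
    using assms
  proof induction
    case ident
    show ?case by (intro exI[of _ "\<lambda>x. 1"]) (auto intro: smooth_expr.intros)
  next
    case (const c)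
    show ?case by (intro exI[of _ "\<lambda>x. 0"]) (auto intro: smooth_expr.intros)
  next
    case (bump k)
    have "smooth_expr (\<lambda>x. exp_bump (k + 2) x + - real k * exp_bump (k + 1) x)"
      by (intro smooth_expr.add smooth_expr.mult smooth_expr.const smooth_expr.bump)
    then show ?case
      using exp_bump_has_derivative[of k] by (intro exI[of _ "\<lambda>x. exp_bump (k + 2) x + - real k * exp_bump (k + 1) x"]) simp
  next
    case (add f g)
    then obtain f' g' where "smooth_expr f'" "smooth_expr g'"
      "\<forall>x. (f has_real_derivative f' x) (at x)" "\<forall>x. (g has_real_derivative g' x) (at x)" by blast
    then show ?case
      by (intro exI[of _ "\<lambda>x. f' x + g' x"]) (auto intro: smooth_expr.intros intro!: derivative_eq_intros)
  next
    case (mult f g)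
    then obtain f' g' where "smooth_expr f'" "smooth_expr g'"
      "\<forall>x. (f has_real_derivative f' x) (at x)" "\<forall>x. (g has_real_derivative g' x) (at x)" by blast
    with mult.hyps show ?case
      by (intro exI[of _ "\<lambda>x. f' x * g x + g' x * f x"])
         (auto intro!: smooth_expr.add smooth_expr.mult DERIV_mult)
  next
    case (inverse f)
    then obtain f' where f': "smooth_expr f'" "\<forall>x. (f has_real_derivative f' x) (at x)" by blast
    have "smooth_expr (\<lambda>x. - 1 * (inverse (f x) * f' x * inverse (f x)))"
      using f' inverse.hyps by (intro smooth_expr.mult smooth_expr.const smooth_expr.inverse)
    moreover have "((\<lambda>x. inverse (f x)) has_real_derivative
        - 1 * (inverse (f x) * f' x * inverse (f x))) (at x)" for x
      using DERIV_inverse'[of f "f' x" x UNIV] f' inverse.hyps by simp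
    ultimately show ?case by blast
  next
    case (compose f g)
    then obtain f' g' where fg: "smooth_expr f'" "smooth_expr g'"
      "\<forall>x. (f has_real_derivative f' x) (at x)" "\<forall>x. (g has_real_derivative g' x) (at x)" by blast
    with compose.hyps have "smooth_expr (\<lambda>x. f' (g x) * g' x)"
      using fg by (intro smooth_expr.mult smooth_expr.compose[of f' g])
    moreover have "((\<lambda>x. f (g x)) has_real_derivative f' (g x) * g' x) (at x)" for x
      using fg by (intro DERIV_chain2) auto
    ultimately show ?case by blast
  qed
  then obtain f' where f': "smooth_expr f'" "\<forall>x. (f has_real_derivative f' x) (at x)" by blast
  then have "deriv f = f'" using DERIV_imp_deriv by blast
  with f' show ?thesis by (auto simp: real_differentiable_def)
qed

lemma smooth_expr_iterated_deriv:
  assumes "smooth_expr f"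
  shows "smooth_expr ((deriv ^^ n) f)"
  by (induction n) (auto simp: assms smooth_expr_deriv)

lemma test_functionI:
  assumes "smooth_expr f" "0 < a" "a < b" "\<And>x. x \<notin> {a..b} \<Longrightarrow> f x = 0"
  shows "test_function f"
  unfolding test_function_def
  using smooth_expr_iterated_deriv[OF assms(1)] smooth_expr_deriv assms(2-4) by blast

text \<open>The usual transition g(x) / (g(x) + g(1 - x)) with g(x) = e^(-1/x), equal to 0 for x
  \<le> 0 and to 1 for x \<ge> 1. It is spelled with \<open>inverse\<close> and
  \<open>1 + - 1 * x\<close> to match the constructors of \<open>smooth_expr\<close>.\<close>

definition smooth_step :: "real \<Rightarrow> real" where
  "smooth_step x = exp_bump 0 x * inverse (exp_bump 0 x + exp_bump 0 (1 + - 1 * x))"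

lemma exp_bump_0_nonneg: "0 \<le> exp_bump 0 x"
  by (simp add: exp_bump_def)

lemma exp_bump_0_mono: "x \<le> y \<Longrightarrow> exp_bump 0 x \<le> exp_bump 0 y"
  by (auto simp: exp_bump_def frac_le)

lemma smooth_step_denominator_pos: "0 < exp_bump 0 x + exp_bump 0 (1 + - 1 * x)"
  by (simp add: exp_bump_def add_pos_pos)

lemma smooth_expr_step: "smooth_expr smooth_step"
proof -
  have "smooth_expr (\<lambda>x. exp_bump 0 x * inverse (exp_bump 0 x + exp_bump 0 (1 + - 1 * x)))"
    using smooth_step_denominator_pos
    by (intro smooth_expr.mult smooth_expr.inverse smooth_expr.add smooth_expr.bump
          smooth_expr.const smooth_expr.ident smooth_expr.compose[of "exp_bump 0" "\<lambda>x. 1 + - 1 * x"])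
       (auto simp: less_le)
  then show ?thesis
    by (simp add: smooth_step_def[abs_def])
qed

lemma smooth_step_eq_0: "x \<le> 0 \<Longrightarrow> smooth_step x = 0"
  by (simp add: smooth_step_def exp_bump_def)

lemma smooth_step_eq_1: "1 \<le> x \<Longrightarrow> smooth_step x = 1"
  by (simp add: smooth_step_def exp_bump_def)

lemma smooth_step_mono: "x \<le> y \<Longrightarrow> smooth_step x \<le> smooth_step y"
proof -
  assume xy: "x \<le> y"
  \<comment> \<open>This is the claim after clearing denominators; the common product of the two
    bumps at x and y cancels.\<close>
  have "exp_bump 0 x * exp_bump 0 (1 + - 1 * y) \<le> exp_bump 0 y * exp_bump 0 (1 + - 1 * x)"
    using xy by (intro mult_mono exp_bump_0_mono exp_bump_0_nonneg) auto
  then show ?thesis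
    unfolding smooth_step_def divide_inverse[symmetric]
    using smooth_step_denominator_pos[of x] smooth_step_denominator_pos[of y]
    by (simp add: divide_simps algebra_simps)
qed

lemma smooth_step_bounds: "0 \<le> smooth_step x" "smooth_step x \<le> 1"
  using smooth_step_mono[of "min x 0" x] smooth_step_mono[of x "max x 1"]
  by (auto simp: smooth_step_eq_0 smooth_step_eq_1)

lemma smooth_step_has_derivative: "(smooth_step has_real_derivative deriv smooth_step x) (at x)"
  using smooth_expr_deriv[OF smooth_expr_step] DERIV_deriv_iff_real_differentiable by blast

lemma deriv_smooth_step_nonneg: "0 \<le> deriv smooth_step x"
proof (rule ccontr)
  assume "\<not> 0 \<le> deriv smooth_step x"
  then obtain d where "d > 0" "\<forall>h>0. h < d \<longrightarrow> smooth_step (x + h) < smooth_step x"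
    using DERIV_neg_dec_right[OF smooth_step_has_derivative[of x]] by auto
  then have "smooth_step (x + d / 2) < smooth_step x" by simp
  with smooth_step_mono[of x "x + d / 2"] \<open>d > 0\<close> show False by simp
qed

lemma continuous_deriv_smooth_step: "continuous_on A (deriv smooth_step)"
  using smooth_expr_deriv smooth_expr_step
  by (meson continuous_at_imp_continuous_on differentiable_imp_continuous_within)

section \<open>Primitives and weak derivatives\<close>

text \<open>Local absolute continuity of \<open>u\<close> on (0,\<infinity>) with an explicit
  density \<open>w\<close>. The pair replaces the weak derivative, which is only a choice;
  \<open>w\<close> is Borel on the whole line so that densities can be combined freely.\<close>

definition primitive :: "(real \<Rightarrow> real) \<Rightarrow> (real \<Rightarrow> real) \<Rightarrow> bool" where
  "primitive u w \<longleftrightarrow> w \<in> borel_measurable borel \<and>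
     (\<forall>x y. 0 < x \<longrightarrow> x \<le> y \<longrightarrow>
        set_integrable lborel {x..y} w \<and> u y - u x = (LINT s:{x..y}|lborel. w s))"

lemma primitive_borel: "primitive u w \<Longrightarrow> w \<in> borel_measurable borel"
  by (simp add: primitive_def)

lemma primitive_integrable: "primitive u w \<Longrightarrow> 0 < x \<Longrightarrow> set_integrable lborel {x..y} w"
  by (cases "x \<le> y") (auto simp: primitive_def)

lemma primitive_diff: "primitive u w \<Longrightarrow> 0 < x \<Longrightarrow> x \<le> y \<Longrightarrow> u y - u x = (LINT s:{x..y}|lborel. w s)"
  by (simp add: primitive_def)

lemma primitive_continuous:
  assumes "primitive u w"
  shows "continuous_on {0<..} u"
proof -
  have "continuous_on {x..y} u" if "0 < x" for x y
  proof -
    have "continuous_on {x..y} (\<lambda>r. u x + integral {x..r} w)"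
      by (intro continuous_on_add continuous_on_const indefinite_integral_continuous_1
            set_borel_integral_eq_integral(1) primitive_integrable[OF assms that])
    moreover have "u x + integral {x..r} w = u r" if r: "r \<in> {x..y}" for r
      using primitive_diff[OF assms \<open>0 < x\<close>, of r] r
        set_borel_integral_eq_integral(2)[OF primitive_integrable[OF assms \<open>0 < x\<close>, of r]] by simp
    ultimately show ?thesis by (metis (no_types, lifting) continuous_on_cong)
  qed
  then have "continuous_on {x / 2<..<x + 1} u" if "0 < x" for x
    using that by (meson continuous_on_subset greaterThanLessThan_subseteq_atLeastAtMost_iff
        half_gt_zero order_refl)
  then have "isCont u x" if "0 < x" for x
    using that continuous_on_interior[of "{x / 2<..<x + 1}" u x] by (auto simp: interior_open)
  then show ?thesis by (auto intro: continuous_at_imp_continuous_on)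
qed

lemma set_integrable_mult_continuous:
  fixes v g :: "real \<Rightarrow> real"
  assumes "set_integrable lborel {x..y} v" "continuous_on {x..y} g"
  shows "set_integrable lborel {x..y} (\<lambda>r. v r * g r)"
proof -
  have "bounded (g ` {x..y})"
    using assms(2) by (intro compact_imp_bounded compact_continuous_image) auto
  then obtain C where C: "\<And>r. r \<in> {x..y} \<Longrightarrow> \<bar>g r\<bar> \<le> C"
    unfolding bounded_iff by (metis imageI real_norm_def)
  have int: "integrable lborel (\<lambda>r. indicator {x..y} r * v r)"
    using assms(1) by (simp add: set_integrable_def)
  have "(\<lambda>r. indicator {x..y} r * g r) \<in> borel_measurable borel"
    using borel_integrable_atLeastAtMost'[OF assms(2)]
    by (auto simp: set_integrable_def dest: borel_measurable_integrable)
  then have meas: "(\<lambda>r. (indicator {x..y} r * v r) * (indicator {x..y} r * g r)) \<in> borel_measurable lborel"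
    using borel_measurable_integrable[OF int] by simp
  have "integrable lborel (\<lambda>r. (indicator {x..y} r * v r) * (indicator {x..y} r * g r))"
  proof (rule Bochner_Integration.integrable_bound[OF _ meas])
    show "integrable lborel (\<lambda>r. C * (indicator {x..y} r * v r))"
      using int by simp
    have "\<bar>g r\<bar> * \<bar>v r\<bar> \<le> \<bar>C\<bar> * \<bar>v r\<bar>" if "r \<in> {x..y}" for r
      using C[OF that] by (intro mult_right_mono) auto
    then show "AE r in lborel. norm (indicator {x..y} r * v r * (indicator {x..y} r * g r))
        \<le> norm (C * (indicator {x..y} r * v r))"
      by (intro AE_I2) (auto simp: indicator_def abs_mult mult.commute)
  qed
  then show ?thesis
    unfolding set_integrable_def
    by (rule Bochner_Integration.integrable_cong[THEN iffD1, rotated 2]) (auto simp: indicator_def)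
qed

text \<open>Both sides are the integral of \<open>v s * w r\<close> over the triangle x \<le> s
  \<le> r \<le> y, in the two orders. Fubini replaces a pointwise product rule, since the densities
  are merely integrable.\<close>

lemma primitive_integral_swap:
  assumes f: "primitive f v" and g: "primitive g w" and "0 < x" "x \<le> y"
  shows "(LINT r:{x..y}|lborel. (f r - f x) * w r) = (LINT s:{x..y}|lborel. v s * (g y - g s))"
proof -
  define V where "V s = indicator {x..y} s * v s" for s
  define W where "W r = indicator {x..y} r * w r" for r
  define F where "F r s = (if s \<le> r then W r * V s else 0)" for r s
  have V: "integrable lborel V" and W: "integrable lborel W"
    using primitive_integrable[OF f \<open>0 < x\<close>, of y] primitive_integrable[OF g \<open>0 < x\<close>, of y]
    by (simp_all add: V_def[abs_def] W_def[abs_def] set_integrable_def)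
  note [measurable] = borel_measurable_integrable[OF V] borel_measurable_integrable[OF W]
  have F_meas: "case_prod F \<in> borel_measurable (lborel \<Otimes>\<^sub>M lborel)"
    unfolding F_def by measurable
  have F_int: "integrable lborel (F r)" for r
  proof (rule Bochner_Integration.integrable_bound)
    show "integrable lborel (\<lambda>s. W r * V s)" using V by simp
    show "F r \<in> borel_measurable lborel" unfolding F_def by measurable
  qed (simp add: F_def)
  have "integrable (lborel \<Otimes>\<^sub>M lborel) (case_prod F)"
  proof (rule lborel_pair.Fubini_integrable[OF F_meas])
    show "integrable lborel (\<lambda>r. \<integral>s. norm (case (r, s) of (r, s) \<Rightarrow> F r s) \<partial>lborel)"
    proof (rule Bochner_Integration.integrable_bound[of _ "\<lambda>r. W r * (\<integral>s. \<bar>V s\<bar> \<partial>lborel)"])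
      show "(\<lambda>r. \<integral>s. norm (case (r, s) of (r, s) \<Rightarrow> F r s) \<partial>lborel) \<in> borel_measurable lborel"
        using F_meas by measurable
      have "(\<integral>s. \<bar>F r s\<bar> \<partial>lborel) \<le> (\<integral>s. \<bar>W r\<bar> * \<bar>V s\<bar> \<partial>lborel)" for r
      proof (rule integral_mono)
        show "integrable lborel (\<lambda>s. \<bar>F r s\<bar>)" by (intro integrable_abs F_int)
        show "integrable lborel (\<lambda>s. \<bar>W r\<bar> * \<bar>V s\<bar>)" using V by simp
      qed (simp add: F_def abs_mult)
      then show "AE r in lborel. norm (\<integral>s. norm (case (r, s) of (r, s) \<Rightarrow> F r s) \<partial>lborel)
          \<le> norm (W r * (\<integral>s. \<bar>V s\<bar> \<partial>lborel))"
        by (simp add: abs_mult)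
    qed (use W in simp)
  qed (use F_int in simp)
  from lborel_pair.Fubini_integral[OF this]
  have "(\<integral>s. (\<integral>r. F r s \<partial>lborel) \<partial>lborel) = (\<integral>r. (\<integral>s. F r s \<partial>lborel) \<partial>lborel)" .
  moreover have "(\<integral>s. F r s \<partial>lborel) = indicator {x..y} r * ((f r - f x) * w r)" for r
  proof (cases "r \<in> {x..y}")
    case True
    then have "f r - f x = (\<integral>s. indicator {x..r} s * v s \<partial>lborel)"
      using primitive_diff[OF f \<open>0 < x\<close>, of r] by (simp add: set_lebesgue_integral_def)
    moreover have "F r s = w r * (indicator {x..r} s * v s)" for s
      using True by (auto simp: F_def V_def W_def indicator_def)
    ultimately show ?thesis using True by simp
  next
    case False
    then have "F r s = 0" for s by (auto simp: F_def W_def)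
    with False show ?thesis by simp
  qed
  moreover have "(\<integral>r. F r s \<partial>lborel) = indicator {x..y} s * (v s * (g y - g s))" for s
  proof (cases "s \<in> {x..y}")
    case True
    then have "g y - g s = (\<integral>r. indicator {s..y} r * w r \<partial>lborel)"
      using primitive_diff[OF g, of s y] \<open>0 < x\<close> by (simp add: set_lebesgue_integral_def)
    moreover have "F r s = v s * (indicator {s..y} r * w r)" for r
      using True by (auto simp: F_def V_def W_def indicator_def)
    ultimately show ?thesis using True by simp
  next
    case False
    then have "F r s = 0" for r by (auto simp: F_def V_def)
    with False show ?thesis by simp
  qed
  ultimately show ?thesis
    by (simp add: set_lebesgue_integral_def)
qed

lemma primitive_integration_by_parts:
  assumes f: "primitive f v" and g: "primitive g w" and "0 < x" "x \<le> y"
  shows "set_integrable lborel {x..y} (\<lambda>r. v r * g r)"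
    and "set_integrable lborel {x..y} (\<lambda>r. f r * w r)"
    and "(LINT r:{x..y}|lborel. v r * g r) + (LINT r:{x..y}|lborel. f r * w r) = f y * g y - f x * g x"
proof -
  have cont: "continuous_on {x..y} f" "continuous_on {x..y} g"
    using primitive_continuous[OF f] primitive_continuous[OF g] \<open>0 < x\<close>
    by (auto intro: continuous_on_subset)
  note v = primitive_integrable[OF f \<open>0 < x\<close>, of y] and w = primitive_integrable[OF g \<open>0 < x\<close>, of y]
  show vg: "set_integrable lborel {x..y} (\<lambda>r. v r * g r)"
    by (rule set_integrable_mult_continuous[OF v cont(2)])
  show fw: "set_integrable lborel {x..y} (\<lambda>r. f r * w r)"
    using set_integrable_mult_continuous[OF w cont(1)] by (simp add: mult.commute)
  have "(LINT r:{x..y}|lborel. f r * w r) - f x * (LINT r:{x..y}|lborel. w r) =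
      (LINT r:{x..y}|lborel. (f r - f x) * w r)"
    using fw w by (simp add: left_diff_distrib flip: set_integral_mult_right)
  also have "\<dots> = (LINT s:{x..y}|lborel. v s * (g y - g s))"
    by (rule primitive_integral_swap[OF assms])
  also have "\<dots> = (LINT s:{x..y}|lborel. v s) * g y - (LINT s:{x..y}|lborel. v s * g s)"
    using vg v by (simp add: right_diff_distrib flip: set_integral_mult_left)
  finally show "(LINT r:{x..y}|lborel. v r * g r) + (LINT r:{x..y}|lborel. f r * w r) = f y * g y - f x * g x"
    using primitive_diff[OF f assms(3,4)] primitive_diff[OF g assms(3,4)]
    by (simp add: algebra_simps)
qed

section \<open>Densities are weak derivatives\<close>

lemma primitive_C1:
  assumes "\<And>x. (g has_real_derivative g' x) (at x)" "continuous_on UNIV g'"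
  shows "primitive g g'"
  unfolding primitive_def
proof (intro conjI allI impI)
  show "g' \<in> borel_measurable borel"
    using assms(2) by (rule borel_measurable_continuous_onI)
  fix x y :: real assume "x \<le> y"
  have cont: "continuous_on {x..y} g'" using assms(2) continuous_on_subset by blast
  then show "set_integrable lborel {x..y} g'" by (rule borel_integrable_atLeastAtMost')
  show "g y - g x = (LINT s:{x..y}|lborel. g' s)"
    unfolding set_lebesgue_integral_def using assms(1) \<open>x \<le> y\<close> cont
    by (intro integral_FTC_atLeastAtMost[symmetric])
       (auto simp: has_real_derivative_iff_has_vector_derivative[symmetric]
             intro: has_field_derivative_at_within)
qed

lemma set_integral_concentrated:
  assumes "\<And>x. x \<notin> B \<Longrightarrow> h x = (0::real)" "B \<subseteq> A"
  shows "set_lebesgue_integral M A h = set_lebesgue_integral M B h"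
  unfolding set_lebesgue_integral_def
  using assms by (intro Bochner_Integration.integral_cong) (auto simp: indicator_def)

lemma test_function_zero_deriv:
  assumes "\<forall>x. x \<notin> {a..b} \<longrightarrow> \<phi> x = (0::real)" "x \<notin> {a..b}"
  shows "deriv \<phi> x = 0"
proof -
  have "(\<phi> has_real_derivative 0) (at x)"
    by (rule has_field_derivative_transform_within_open[of "\<lambda>_. 0" _ _ "- {a..b}"])
       (use assms in auto)
  then show ?thesis by (rule DERIV_imp_deriv)
qed

lemma Lp_loc_continuous:
  assumes "continuous_on {0<..} u" "0 < p"
  shows "Lp_loc p u"
  unfolding Lp_loc_def
proof (intro conjI allI impI)
  show "set_borel_measurable lborel {0<..} u"
    using borel_measurable_continuous_on_indicator[OF _ assms(1)]
    by (simp add: set_borel_measurable_def)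
next
  fix a b :: real assume "0 < a" "a < b"
  then have "continuous_on {a..b} (\<lambda>r. \<bar>u r\<bar> powr p)"
    using assms by (intro continuous_intros continuous_on_powr'
        continuous_on_subset[OF assms(1)]) auto
  then show "set_integrable lborel {a..b} (\<lambda>r. \<bar>u r\<bar> powr p)"
    by (rule borel_integrable_atLeastAtMost')
qed

lemma primitive_has_weak_deriv:
  assumes "primitive u w"
  shows "has_weak_deriv u w"
  unfolding has_weak_deriv_def
proof (intro conjI allI impI)
  show "Lp_loc 1 u"
    using primitive_continuous[OF assms] by (intro Lp_loc_continuous) auto
  show "Lp_loc 1 w"
    using primitive_borel[OF assms] set_integrable_abs[OF primitive_integrable[OF assms]]
    by (simp add: Lp_loc_def set_borel_measurable_def)
  fix \<phi> assume "test_function \<phi>"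
  then obtain a b where ab: "0 < a" "a < b" and zero: "\<forall>x. x \<notin> {a..b} \<longrightarrow> \<phi> x = 0"
    and diff: "\<And>n x. (deriv ^^ n) \<phi> differentiable at x"
    by (auto simp: test_function_def)
  have "primitive \<phi> (deriv \<phi>)"
  proof (rule primitive_C1)
    show "(\<phi> has_real_derivative deriv \<phi> x) (at x)" for x
      using diff[of 0 x] by (simp add: DERIV_deriv_iff_real_differentiable)
    show "continuous_on UNIV (deriv \<phi>)"
      using diff[of 1] by (auto intro: continuous_at_imp_continuous_on differentiable_imp_continuous_within)
  qed
  \<comment> \<open>Both endpoints lie outside the support interval \<open>{a..b}\<close>, so the
    boundary terms vanish.\<close>
  from primitive_integration_by_parts(3)[OF assms this, of "a / 2" "b + 1"]
  have "(LINT r:{a / 2..b + 1}|lborel. w r * \<phi> r) + (LINT r:{a / 2..b + 1}|lborel. u r * deriv \<phi> r) = 0"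
    using ab zero by simp
  moreover have "(LINT r:{0<..}|lborel. w r * \<phi> r) = (LINT r:{a / 2..b + 1}|lborel. w r * \<phi> r)"
    using ab zero by (intro set_integral_concentrated) auto
  moreover have "(LINT r:{0<..}|lborel. u r * deriv \<phi> r) = (LINT r:{a / 2..b + 1}|lborel. u r * deriv \<phi> r)"
    using ab test_function_zero_deriv[OF zero] by (intro set_integral_concentrated) auto
  ultimately show "(LINT r:{0<..}|lborel. u r * deriv \<phi> r) = - (LINT r:{0<..}|lborel. w r * \<phi> r)"
    by simp
qed

section \<open>Weak derivatives of continuous functions are densities\<close>

lemma smooth_step_mollifier:
  fixes x c :: real
  assumes "0 < c"
  shows "set_integrable lborel {x..x + 1 / c} (\<lambda>z. c * deriv smooth_step (c * (z - x)))"
    and "(LINT z:{x..x + 1 / c}|lborel. c * deriv smooth_step (c * (z - x))) = 1"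
proof -
  have cont: "continuous_on {x..x + 1 / c} (\<lambda>z. c * deriv smooth_step (c * (z - x)))"
    by (intro continuous_intros continuous_on_compose2[OF continuous_deriv_smooth_step[of UNIV]]) auto
  then show "set_integrable lborel {x..x + 1 / c} (\<lambda>z. c * deriv smooth_step (c * (z - x)))"
    by (rule borel_integrable_atLeastAtMost')
  have "(LINT z:{x..x + 1 / c}|lborel. c * deriv smooth_step (c * (z - x))) =
      smooth_step (c * (x + 1 / c - x)) - smooth_step (c * (x - x))"
    unfolding set_lebesgue_integral_def
    using smooth_step_has_derivative cont assms
    by (intro integral_FTC_atLeastAtMost)
       (auto simp: has_real_derivative_iff_has_vector_derivative[symmetric]
             intro!: derivative_eq_intros DERIV_chain'[where f = "\<lambda>z. c * (z - x)" and g = smooth_step, THEN DERIV_cong])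
  then show "(LINT z:{x..x + 1 / c}|lborel. c * deriv smooth_step (c * (z - x))) = 1"
    using assms by (simp add: smooth_step_eq_0 smooth_step_eq_1)
qed

lemma deriv_smooth_step_eq_0: "x \<notin> {0..1} \<Longrightarrow> deriv smooth_step x = 0"
proof -
  assume x: "x \<notin> {0..1}"
  have "(smooth_step has_real_derivative 0) (at x)"
  proof (cases "x < 0")
    case True
    show ?thesis
      by (rule has_field_derivative_transform_within_open[of "\<lambda>_. 0" _ _ "{..<0}"])
         (use True in \<open>auto simp: smooth_step_eq_0\<close>)
  next
    case False
    show ?thesis
      by (rule has_field_derivative_transform_within_open[of "\<lambda>_. 1" _ _ "{1<..}"])
         (use x False in \<open>auto simp: smooth_step_eq_1\<close>)
  qed
  then show ?thesis by (rule DERIV_imp_deriv)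
qed

text \<open>The kernel is nonnegative with mass one and sits on [x, x + 1/c], to the right of x and
  hence inside (0,\<infinity>). The integral is an average of values of \<open>f\<close> near x, so
  continuity gives the limit at every point, not just almost everywhere.\<close>

lemma smooth_step_mollifier_limit:
  assumes f: "continuous_on {0<..} f" and "0 < x"
  shows "((\<lambda>c. LINT z:{x..x + 1 / c}|lborel. f z * (c * deriv smooth_step (c * (z - x)))) \<longlongrightarrow> f x) at_top"
proof (rule tendstoI)
  fix e :: real assume "0 < e"
  have "continuous (at x) f"
    using f \<open>0 < x\<close> by (simp add: continuous_on_eq_continuous_at)
  then obtain d where d: "d > 0" "\<And>z. \<bar>z - x\<bar> < d \<Longrightarrow> \<bar>f z - f x\<bar> < e / 2"
    using \<open>0 < e\<close> unfolding continuous_at_eps_delta by (metis dist_real_def half_gt_zero)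
  have "dist (LINT z:{x..x + 1 / c}|lborel. f z * (c * deriv smooth_step (c * (z - x)))) (f x) < e"
    if c: "c > 1 / d" for c
  proof -
    define \<eta> where "\<eta> z = c * deriv smooth_step (c * (z - x))" for z
    have "c > 0" using c d(1) by (meson less_trans zero_less_divide_1_iff)
    have eta: "set_integrable lborel {x..x + 1 / c} \<eta>" "(LINT z:{x..x + 1 / c}|lborel. \<eta> z) = 1"
      using smooth_step_mollifier[OF \<open>c > 0\<close>, of x] unfolding \<eta>_def by blast+
    have eta_nonneg: "0 \<le> \<eta> z" for z
      using \<open>c > 0\<close> deriv_smooth_step_nonneg by (simp add: \<eta>_def)
    have "continuous_on {x..x + 1 / c} f"
      using \<open>0 < x\<close> by (auto intro: continuous_on_subset[OF f])
    then have f_eta: "set_integrable lborel {x..x + 1 / c} (\<lambda>z. f z * \<eta> z)"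
      using set_integrable_mult_continuous[OF eta(1), of f] by (simp add: mult.commute)
    have "1 / c < d" using c \<open>c > 0\<close> d(1) by (simp add: field_simps)
    then have near: "\<bar>f z - f x\<bar> < e / 2" if "z \<in> {x..x + 1 / c}" for z
      using that by (intro d(2)) auto
    have lower: "f x - e / 2 \<le> f z" and upper: "f z \<le> f x + e / 2" if "z \<in> {x..x + 1 / c}" for z
      using near[OF that] by linarith+
    have "(LINT z:{x..x + 1 / c}|lborel. (f x - e / 2) * \<eta> z) \<le> (LINT z:{x..x + 1 / c}|lborel. f z * \<eta> z)"
      using eta(1) f_eta eta_nonneg lower upper by (intro set_integral_mono mult_right_mono) auto
    moreover have "(LINT z:{x..x + 1 / c}|lborel. f z * \<eta> z) \<le> (LINT z:{x..x + 1 / c}|lborel. (f x + e / 2) * \<eta> z)"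
      using eta(1) f_eta eta_nonneg lower upper by (intro set_integral_mono mult_right_mono) auto
    ultimately show ?thesis
      using \<open>0 < e\<close> eta(2) by (simp add: dist_real_def \<eta>_def[symmetric] abs_less_iff)
  qed
  then show "\<forall>\<^sub>F c in at_top. dist (LINT z:{x..x + 1 / c}|lborel. f z * (c * deriv smooth_step (c * (z - x)))) (f x) < e"
    by (rule eventually_mono[OF eventually_gt_at_top])
qed

text \<open>The weak derivative is tested with a difference of two shifted steps, a smooth version
  of the indicator of (x, y]. Its derivative is the difference of the mollifiers at x and y.\<close>

lemma weak_deriv_smooth_step:
  assumes wd: "has_weak_deriv f v" and f: "continuous_on {0<..} f"
    and "0 < x" "x < y" "1 \<le> c"
  shows "(LINT z:{x..x + 1 / c}|lborel. f z * (c * deriv smooth_step (c * (z - x)))) -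
         (LINT z:{y..y + 1 / c}|lborel. f z * (c * deriv smooth_step (c * (z - y)))) =
       - (LINT z:{0<..}|lborel. v z * (smooth_step (c * (z - x)) - smooth_step (c * (z - y))))"
proof -
  define \<phi> where "\<phi> z = smooth_step (c * (z - x)) - smooth_step (c * (z - y))" for z
  have affine: "smooth_expr (\<lambda>z. smooth_step (c * z + c * - a))" for a
    by (intro smooth_expr.compose[OF smooth_expr_step, of "\<lambda>z. c * z + c * - a"]
        smooth_expr.add smooth_expr.mult smooth_expr.const smooth_expr.ident)
  have "smooth_expr (\<lambda>z. smooth_step (c * z + c * - x) + - 1 * smooth_step (c * z + c * - y))"
    by (intro smooth_expr.add smooth_expr.mult smooth_expr.const affine)
  then have "smooth_expr \<phi>"
    by (simp add: \<phi>_def[abs_def] algebra_simps)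
  moreover have "\<phi> z = 0" if "z \<notin> {x..y + 1}" for z
  proof (cases "z < x")
    case True
    then have "c * (z - x) \<le> 0" "c * (z - y) \<le> 0"
      using assms(3-5) by (auto simp: mult_le_0_iff)
    then show ?thesis by (simp add: \<phi>_def smooth_step_eq_0)
  next
    case False
    \<comment> \<open>Beyond \<open>y + 1\<close> both steps have reached 1 and cancel. This is
      where 1 \<le> c enters: it keeps the support inside \<open>{x..y + 1}\<close> for all such
      c.\<close>
    then have "1 * 1 \<le> c * (z - x)" "1 * 1 \<le> c * (z - y)"
      using assms(3-5) that by (intro mult_mono; simp)+
    then show ?thesis by (simp add: \<phi>_def smooth_step_eq_1)
  qed
  ultimately have "test_function \<phi>"
    using assms(3,4) by (intro test_functionI[of \<phi> x "y + 1"]) auto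
  then have eq: "(LINT r:{0<..}|lborel. f r * deriv \<phi> r) = - (LINT r:{0<..}|lborel. v r * \<phi> r)"
    using wd by (simp add: has_weak_deriv_def)
  define \<eta> where "\<eta> a z = c * deriv smooth_step (c * (z - a))" for a z
  have deriv: "deriv \<phi> z = \<eta> x z - \<eta> y z" for z
    unfolding \<phi>_def[abs_def] \<eta>_def
    by (intro DERIV_imp_deriv DERIV_diff
        DERIV_chain'[where f = "\<lambda>z. c * (z - _)" and g = smooth_step, THEN DERIV_cong])
       (auto intro!: derivative_eq_intros smooth_step_has_derivative simp: mult.commute)
  have eta_0: "\<eta> a z = 0" if "z \<notin> {a..a + 1 / c}" for a z
  proof -
    have "c * (z - a) \<notin> {0..1}"
      using that \<open>1 \<le> c\<close> by (auto simp: zero_le_mult_iff field_simps)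
    then show ?thesis by (simp add: \<eta>_def deriv_smooth_step_eq_0)
  qed
  have int: "set_integrable lborel {0<..} (\<lambda>z. f z * \<eta> a z)" and
    conc: "(LINT z:{0<..}|lborel. f z * \<eta> a z) = (LINT z:{a..a + 1 / c}|lborel. f z * \<eta> a z)" if "0 < a" for a
  proof -
    have "continuous_on {a..a + 1 / c} f"
      using that by (auto intro: continuous_on_subset[OF f])
    then have "set_integrable lborel {a..a + 1 / c} (\<lambda>z. f z * \<eta> a z)"
      using set_integrable_mult_continuous[OF smooth_step_mollifier(1), of c a f] \<open>1 \<le> c\<close>
      by (simp add: mult.commute \<eta>_def)
    moreover have "indicator {0<..} z *\<^sub>R (f z * \<eta> a z) = indicator {a..a + 1 / c} z *\<^sub>R (f z * \<eta> a z)" for z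
      using eta_0[of z a] that by (auto simp: indicator_def)
    ultimately show "set_integrable lborel {0<..} (\<lambda>z. f z * \<eta> a z)"
      unfolding set_integrable_def by presburger
    show "(LINT z:{0<..}|lborel. f z * \<eta> a z) = (LINT z:{a..a + 1 / c}|lborel. f z * \<eta> a z)"
      using eta_0 that by (intro set_integral_concentrated) auto
  qed
  have "(LINT r:{0<..}|lborel. f r * deriv \<phi> r) =
      (LINT z:{0<..}|lborel. f z * \<eta> x z) - (LINT z:{0<..}|lborel. f z * \<eta> y z)"
    using int[of x] int[of y] assms(3,4) by (simp add: deriv right_diff_distrib)
  then show ?thesis
    using eq conc[of x] conc[of y] assms(3,4) by (simp add: \<eta>_def \<phi>_def)
qed

lemma smooth_step_scaled_limit:
  assumes "z \<noteq> a"
  shows "(\<lambda>n. smooth_step (real (Suc n) * (z - a))) \<longlonglongrightarrow> indicator {a<..} z"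
proof (cases "z < a")
  case True
  then have "smooth_step (real (Suc n) * (z - a)) = 0" for n
    by (intro smooth_step_eq_0) (simp add: mult_le_0_iff)
  with True show ?thesis by simp
next
  case False
  with assms have "a < z" by simp
  then have "\<forall>\<^sub>F n in sequentially. 1 / (z - a) \<le> real (Suc n)"
    by (meson eventually_sequentiallyI le_SucI nat_ceiling_le_eq of_nat_mono order_trans real_nat_ceiling_ge)
  then have "\<forall>\<^sub>F n in sequentially. smooth_step (real (Suc n) * (z - a)) = 1"
    by (rule eventually_mono) (use \<open>a < z\<close> in \<open>auto intro!: smooth_step_eq_1 simp: field_simps\<close>)
  with \<open>a < z\<close> show ?thesis by (simp add: tendsto_eventually)
qed

lemma Lp_loc_1_integrable:
  assumes "Lp_loc 1 v" "0 < a"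
  shows "set_integrable lborel {a..b} v"
proof -
  have "set_integrable lborel {a..max b (a + 1)} (\<lambda>r. \<bar>v r\<bar>)"
    using assms by (simp add: Lp_loc_def)
  then have abs: "set_integrable lborel {a..b} (\<lambda>r. \<bar>v r\<bar>)"
    by (rule set_integrable_subset) auto
  have "(\<lambda>r. indicator {0<..} r * v r) \<in> borel_measurable borel"
    using assms(1) by (simp add: Lp_loc_def set_borel_measurable_def)
  then have "(\<lambda>r. indicator {a..b} r * (indicator {0<..} r * v r)) \<in> borel_measurable borel"
    by simp
  moreover have "indicator {a..b} r * (indicator {0<..} r * v r) = indicator {a..b} r * v r" for r
    using \<open>0 < a\<close> by (auto simp: indicator_def)
  ultimately have "set_borel_measurable lborel {a..b} v"
    by (simp add: set_borel_measurable_def)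
  with abs show ?thesis by (simp add: set_integrable_abs_iff)
qed

text \<open>Let c run through n + 1 in the tested identity. The mollified values tend to f(x) -
  f(y), and by dominated convergence the other side tends to minus the integral of \<open>v\<close>
  over (x, y]. The indicator is there because \<open>v\<close> is known to be measurable only on the
  half-line.\<close>

lemma weak_deriv_primitive:
  assumes wd: "has_weak_deriv f v" and f: "continuous_on {0<..} f"
  shows "primitive f (\<lambda>r. indicator {0<..} r * v r)"
proof -
  have v: "Lp_loc 1 v" using wd by (simp add: has_weak_deriv_def)
  have "f y - f x = (LINT s:{x..y}|lborel. v s)" if "0 < x" "x \<le> y" for x y
  proof (cases "x = y")
    case True
    have "(LINT s:{y..y}|lborel. v s) = 0"
      using set_borel_integral_eq_integral(2)[OF Lp_loc_1_integrable[OF v, of y y]] that by simp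
    with True show ?thesis by simp
  next
    case False
    with that have "x < y" by simp
    define \<phi> where "\<phi> n z = smooth_step (real (Suc n) * (z - x)) - smooth_step (real (Suc n) * (z - y))" for n z
    have Suc_lim: "filterlim (\<lambda>n. real (Suc n)) at_top sequentially"
      by (rule filterlim_compose[OF filterlim_real_sequentially filterlim_Suc])
    have lim1: "(\<lambda>n. - (LINT z:{0<..}|lborel. v z * \<phi> n z)) \<longlonglongrightarrow> f x - f y"
    proof -
      have "(\<lambda>n. (LINT z:{x..x + 1 / real (Suc n)}|lborel. f z * (real (Suc n) * deriv smooth_step (real (Suc n) * (z - x)))) -
         (LINT z:{y..y + 1 / real (Suc n)}|lborel. f z * (real (Suc n) * deriv smooth_step (real (Suc n) * (z - y)))))
         \<longlonglongrightarrow> f x - f y"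
        using \<open>0 < x\<close> \<open>x < y\<close>
        by (intro tendsto_diff filterlim_compose[OF smooth_step_mollifier_limit[OF f] Suc_lim]) auto
      then show ?thesis
        by (subst (asm) weak_deriv_smooth_step[OF wd f \<open>0 < x\<close> \<open>x < y\<close>]) (auto simp: \<phi>_def)
    qed
    have int: "set_integrable lborel {x..y + 1} v"
      using Lp_loc_1_integrable[OF v \<open>0 < x\<close>] .
    have meas_step: "smooth_step \<in> borel_measurable borel"
      using smooth_step_has_derivative
      by (intro borel_measurable_continuous_onI continuous_at_imp_continuous_on) (auto dest: DERIV_isCont)
    have phi_meas [measurable]: "\<phi> n \<in> borel_measurable borel" for n
      unfolding \<phi>_def using measurable_compose[OF _ meas_step] by measurable
    have phi_0: "\<phi> n z = 0" if "z \<notin> {x..y + 1}" for n z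
    proof (cases "z < x")
      case True
      then have "real (Suc n) * (z - x) \<le> 0" "real (Suc n) * (z - y) \<le> 0"
        using \<open>x < y\<close> by (auto simp: mult_le_0_iff)
      then show ?thesis by (simp add: \<phi>_def smooth_step_eq_0)
    next
      case False
      then have "1 * 1 \<le> real (Suc n) * (z - x)" "1 * 1 \<le> real (Suc n) * (z - y)"
        using \<open>x < y\<close> that by (intro mult_mono; simp)+
      then show ?thesis by (simp add: \<phi>_def smooth_step_eq_1)
    qed
    have phi_bound: "\<bar>\<phi> n z\<bar> \<le> 1" for n z
      using smooth_step_bounds[of "real (Suc n) * (z - x)"] smooth_step_bounds[of "real (Suc n) * (z - y)"]
      unfolding \<phi>_def by linarith
    have v_meas [measurable]: "(\<lambda>z. indicator {x..y + 1} z * v z) \<in> borel_measurable borel"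
      using int by (auto simp: set_integrable_def dest: borel_measurable_integrable)
    have lim2: "(\<lambda>n. \<integral>z. (indicator {x..y + 1} z * v z) * \<phi> n z \<partial>lborel) \<longlonglongrightarrow>
        (\<integral>z. (indicator {x..y + 1} z * v z) * indicator {x<..y} z \<partial>lborel)"
    proof (rule integral_dominated_convergence[where w = "\<lambda>z. \<bar>indicator {x..y + 1} z * v z\<bar>"])
      show "integrable lborel (\<lambda>z. \<bar>indicator {x..y + 1} z * v z\<bar>)"
        using int unfolding set_integrable_def by simp
      show "AE z in lborel. norm ((indicator {x..y + 1} z * v z) * \<phi> n z) \<le> \<bar>indicator {x..y + 1} z * v z\<bar>" for n
        using mult_left_le[OF phi_bound abs_ge_zero] 
        by (intro AE_I2) (simp only: real_norm_def abs_mult[where b = "\<phi> n z" for z])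
      have "AE z in lborel. z \<noteq> x" "AE z in lborel. z \<noteq> y"
        by (auto intro: AE_lborel_singleton)
      then show "AE z in lborel. (\<lambda>n. (indicator {x..y + 1} z * v z) * \<phi> n z)
          \<longlonglongrightarrow> (indicator {x..y + 1} z * v z) * indicator {x<..y} z"
      proof eventually_elim
        case (elim z)
        have "(\<lambda>n. \<phi> n z) \<longlonglongrightarrow> indicator {x<..} z - indicator {y<..} z"
          unfolding \<phi>_def using elim by (intro tendsto_diff smooth_step_scaled_limit)
        moreover have "indicator {x<..} z - indicator {y<..} z = (indicator {x<..y} z :: real)"
          using \<open>x < y\<close> by (auto simp: indicator_def)
        ultimately show ?case by (intro tendsto_mult tendsto_const) simp
      qed
    qed measurable
    have "(LINT z:{0<..}|lborel. v z * \<phi> n z) = (\<integral>z. (indicator {x..y + 1} z * v z) * \<phi> n z \<partial>lborel)" for n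
    proof -
      have "(LINT z:{0<..}|lborel. v z * \<phi> n z) = (LINT z:{x..y + 1}|lborel. v z * \<phi> n z)"
        using \<open>0 < x\<close> phi_0 by (intro set_integral_concentrated) auto
      then show ?thesis by (simp add: set_lebesgue_integral_def mult.assoc)
    qed
    with lim1 have "(\<lambda>n. - (\<integral>z. (indicator {x..y + 1} z * v z) * \<phi> n z \<partial>lborel)) \<longlonglongrightarrow> f x - f y"
      by simp
    from LIMSEQ_unique[OF this tendsto_minus[OF lim2]]
    have "f y - f x = (\<integral>z. (indicator {x..y + 1} z * v z) * indicator {x<..y} z \<partial>lborel)"
      by linarith
    also have "\<dots> = (\<integral>z. indicator {x..y} z * v z \<partial>lborel)"
    proof (rule integral_cong_AE)
      have "(\<lambda>z. indicator {x..y} z * (indicator {x..y + 1} z * v z)) \<in> borel_measurable lborel" by measurable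
      moreover have "indicator {x..y} z * (indicator {x..y + 1} z * v z) = indicator {x..y} z * v z" for z
        by (auto simp: indicator_def)
      ultimately show "(\<lambda>z. indicator {x..y} z * v z) \<in> borel_measurable lborel" by simp
      have "AE z in lborel. z \<noteq> x" by (rule AE_lborel_singleton)
      then show "AE z in lborel. (indicator {x..y + 1} z * v z) * indicator {x<..y} z = indicator {x..y} z * v z"
        by eventually_elim (auto simp: indicator_def)
    qed measurable
    finally show ?thesis by (simp add: set_lebesgue_integral_def)
  qed
  moreover have "set_integrable lborel {x..y} (\<lambda>r. indicator {0<..} r * v r) \<longleftrightarrow> set_integrable lborel {x..y} v"
    "(LINT s:{x..y}|lborel. indicator {0<..} s * v s) = (LINT s:{x..y}|lborel. v s)" if "0 < x" for x y
    using that by (intro set_integrable_cong set_lebesgue_integral_cong refl; auto)+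
  moreover have "(\<lambda>r. indicator {0<..} r * v r) \<in> borel_measurable borel"
    using v by (simp add: Lp_loc_def set_borel_measurable_def)
  ultimately show ?thesis
    using Lp_loc_1_integrable[OF v] by (simp add: primitive_def)
qed

text \<open>On a compact interval, the positive and negative parts of \<open>w\<close> are densities
  of measures that agree on all rays \<open>{c<..}\<close>. Such measures are equal, so the two
  parts agree almost everywhere, and two parts that are never both nonzero must then vanish.\<close>

lemma AE_zero_if_integrals_zero:
  fixes w :: "real \<Rightarrow> real"
  assumes w [measurable]: "w \<in> borel_measurable borel"
    and int: "\<And>x y. 0 < x \<Longrightarrow> set_integrable lborel {x..y} w"
    and zero: "\<And>x y. 0 < x \<Longrightarrow> x \<le> y \<Longrightarrow> (LINT s:{x..y}|lborel. w s) = 0"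
  shows "AE r in lborel. 0 < r \<longrightarrow> w r = 0"
proof -
  have "AE r in lborel. r \<in> {a..b} \<longrightarrow> w r = 0" if "0 < a" for a b
  proof -
    define h where "h r = indicator {a..b} r * w r" for r
    have h [measurable]: "h \<in> borel_measurable borel" by (simp add: h_def[abs_def])
    have h_int: "integrable lborel h"
      using int[OF \<open>0 < a\<close>, of b] by (simp add: h_def[abs_def] set_integrable_def)
    have parts: "integrable lborel (\<lambda>r. max 0 (h r) * indicator {c<..} r)"
      "integrable lborel (\<lambda>r. max 0 (- h r) * indicator {c<..} r)" for c
      by (rule Bochner_Integration.integrable_bound[OF h_int]; auto simp: indicator_def)+
    have half: "(\<integral>r. max 0 (h r) * indicator {c<..} r \<partial>lborel) = (\<integral>r. max 0 (- h r) * indicator {c<..} r \<partial>lborel)" for c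
    proof -
      have "(\<integral>r. max 0 (h r) * indicator {c<..} r \<partial>lborel) - (\<integral>r. max 0 (- h r) * indicator {c<..} r \<partial>lborel)
          = (\<integral>r. indicator {max a c..b} r * w r \<partial>lborel)"
      proof (subst Bochner_Integration.integral_diff[symmetric, OF parts], rule integral_cong_AE)
        have "AE r in lborel. r \<noteq> c" by (rule AE_lborel_singleton)
        then show "AE r in lborel. max 0 (h r) * indicator {c<..} r - max 0 (- h r) * indicator {c<..} r =
            indicator {max a c..b} r * w r"
          by eventually_elim (auto simp: h_def indicator_def)
      qed measurable
      also have "\<dots> = 0"
        using zero[of "max a c" b] \<open>0 < a\<close>
        by (cases "max a c \<le> b") (auto simp: set_lebesgue_integral_def)
      finally show ?thesis by simp
    qed
    have emeasure: "emeasure (density lborel (\<lambda>r. ennreal (max 0 (h r)))) {c<..} =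
        ennreal (\<integral>r. max 0 (h r) * indicator {c<..} r \<partial>lborel)"
      "emeasure (density lborel (\<lambda>r. ennreal (max 0 (- h r)))) {c<..} =
        ennreal (\<integral>r. max 0 (- h r) * indicator {c<..} r \<partial>lborel)" for c
      using nn_integral_eq_integral[OF parts(1)[of c]] nn_integral_eq_integral[OF parts(2)[of c]]
      by (auto simp: emeasure_density ennreal_mult' simp flip: ennreal_indicator)
    have "density lborel (\<lambda>r. ennreal (max 0 (h r))) = density lborel (\<lambda>r. ennreal (max 0 (- h r)))"
      by (rule measure_eqI_lessThan) (auto simp: emeasure half)
    then have "AE r in lborel. ennreal (max 0 (h r)) = ennreal (max 0 (- h r))"
      by (subst (asm) sigma_finite_measure.density_unique_iff[OF lborel.sigma_finite_measure_axioms]) auto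
    then show ?thesis
      by eventually_elim (auto simp: h_def max_def split: if_splits)
  qed
  then have "AE r in lborel. \<forall>n. r \<in> {1 / real (Suc n)..real n} \<longrightarrow> w r = 0"
    by (subst AE_all_countable) simp
  then show ?thesis
  proof eventually_elim
    case (elim r)
    show ?case
    proof
      assume "0 < r"
      obtain n :: nat where n: "max r (1 / r) < real n" using reals_Archimedean2 by blast
      then have "1 / real (Suc n) \<le> r" using \<open>0 < r\<close> by (simp add: field_simps)
      with n elim show "w r = 0" by auto
    qed
  qed
qed

lemma primitive_unique_AE:
  assumes "primitive u w" "primitive u w'"
  shows "AE r in lborel. 0 < r \<longrightarrow> w r = w' r"
proof -
  have "AE r in lborel. 0 < r \<longrightarrow> w r - w' r = 0"
  proof (rule AE_zero_if_integrals_zero)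
    show "(\<lambda>r. w r - w' r) \<in> borel_measurable borel"
      using assms by (intro borel_measurable_diff primitive_borel)
    show "set_integrable lborel {x..y} (\<lambda>r. w r - w' r)" if "0 < x" for x y
      using assms that by (intro set_integral_diff primitive_integrable)
    show "(LINT s:{x..y}|lborel. w s - w' s) = 0" if "0 < x" "x \<le> y" for x y
      using assms that primitive_integrable primitive_diff
      by (subst set_integral_diff) (auto, metis)
  qed
  then show ?thesis by simp
qed

text \<open>Whatever function the choice operator picks, it is a density of \<open>u\<close> on
  (0,\<infinity>), and densities are unique almost everywhere. Energies can therefore be computed
  from any explicit density.\<close>

lemma primitive_weak_deriv_AE:
  assumes "primitive u w"
  shows "AE r in lborel. 0 < r \<longrightarrow> weak_deriv u r = w r"
proof -
  have "has_weak_deriv u (weak_deriv u)"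
    unfolding weak_deriv_def using primitive_has_weak_deriv[OF assms] by (rule someI[of "has_weak_deriv u"])
  then have "primitive u (\<lambda>r. indicator {0<..} r * weak_deriv u r)"
    using primitive_continuous[OF assms] by (rule weak_deriv_primitive)
  from primitive_unique_AE[OF this assms] show ?thesis
    by eventually_elim auto
qed

section \<open>Convexity of the gradient term\<close>

lemma powr_above_tangent:
  fixes q s t :: real
  assumes "1 \<le> q" "0 \<le> s" "0 \<le> t"
  shows "s powr q + q * s powr (q - 1) * (t - s) \<le> t powr q"
proof -
  consider "s = 0" | "s > 0" "t = 0" | "s > 0" "t > 0" using assms by linarith
  then show ?thesis
  proof cases
    case 1
    \<comment> \<open>For \<open>q = 1\<close> the slope is \<open>0 powr 0\<close>, which is 0 as
      well, so the tangent at 0 is the zero function in every case.\<close>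
    then show ?thesis by simp
  next
    case 2
    then have "s powr (q - 1) * s = s powr q" by (simp add: powr_diff)
    moreover have "s powr q \<le> q * s powr q" using assms(1) by (simp add: mult_le_cancel_right1)
    ultimately show ?thesis using 2 by (simp add: algebra_simps)
  next
    case 3
    have "((\<lambda>x. x powr q) has_real_derivative q * s powr (q - 1)) (at s within {0<..})"
      using 3 by (auto intro!: derivative_eq_intros)
    from convex_on_imp_above_tangent[OF powr_convex[OF assms(1)] _ _ _ this, of t] 3
    show ?thesis by (simp add: interior_open convex_connected algebra_simps)
  qed
qed

lemma powr_superadditive:
  fixes q s t :: real
  assumes "1 \<le> q" "0 \<le> s" "0 \<le> t"
  shows "s powr q + t powr q \<le> (s + t) powr q"
proof (cases "s + t = 0")
  case True
  with assms have "s = 0" "t = 0" by auto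
  then show ?thesis by simp
next
  case False
  then have pos: "0 < s + t" using assms by simp
  \<comment> \<open>Split off one factor x and enlarge only the remaining power; the bound is then
    linear in x and can be summed over s and t.\<close>
  have "x powr q \<le> (s + t) powr (q - 1) * x" if "0 \<le> x" "x \<le> s + t" for x
  proof (cases "x = 0")
    case False
    then have "x powr q = x powr (q - 1) * x" using that by (simp add: powr_diff)
    also have "\<dots> \<le> (s + t) powr (q - 1) * x"
      using that assms by (intro mult_right_mono powr_mono2) auto
    finally show ?thesis .
  qed simp
  from add_mono[OF this[of s] this[of t]] assms
  have "s powr q + t powr q \<le> (s + t) powr (q - 1) * (s + t)" by (simp add: algebra_simps)
  with pos show ?thesis by (simp add: powr_diff)
qed

lemma powr_midpoint:
  fixes q s t :: real
  assumes "1 \<le> q" "0 \<le> s" "0 \<le> t"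
  shows "2 * ((s + t) / 2) powr q \<le> s powr q + t powr q"
  using powr_above_tangent[of q "(s + t) / 2" s] powr_above_tangent[of q "(s + t) / 2" t] assms
  by (simp add: field_simps)

text \<open>Clarkson's inequality for the pair \<open>(x, y)\<close>, \<open>(a, a)\<close>, combined with the tangent
  inequality at \<open>(a, a)\<close> for their midpoint.\<close>

lemma norm_powr_above_tangent:
  fixes a q x y :: real
  assumes "1 \<le> q" "0 \<le> a"
  shows "(2 * a\<^sup>2) powr q + 2 * q * (2 * a\<^sup>2) powr (q - 1) * a * (x + y - 2 * a)
       + 2 * (((x - a)\<^sup>2 + (y - a)\<^sup>2) / 4) powr q \<le> (x\<^sup>2 + y\<^sup>2) powr q"
proof -
  \<comment> \<open>\<open>u\<close> and \<open>w\<close> are the squared lengths of half the sum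
    and half the difference of (x, y) and (a, a), whence the 4; \<open>s\<close> is the squared
    length of (a, a).\<close>
  define u where "u = ((x + a)\<^sup>2 + (y + a)\<^sup>2) / 4"
  define w where "w = ((x - a)\<^sup>2 + (y - a)\<^sup>2) / 4"
  define s where "s = 2 * a\<^sup>2"
  have nonneg: "0 \<le> u" "0 \<le> w" "0 \<le> s" by (simp_all add: u_def w_def s_def)
  have "u - s - a * (x + y - 2 * a) = w"
    by (simp add: u_def w_def s_def power2_eq_square field_simps)
  then have "q * s powr (q - 1) * (a * (x + y - 2 * a)) \<le> q * s powr (q - 1) * (u - s)"
    using nonneg assms(1) by (intro mult_left_mono) auto
  with powr_above_tangent[OF assms(1) nonneg(3,1)]
  have 1: "s powr q + q * s powr (q - 1) * (a * (x + y - 2 * a)) \<le> u powr q"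
    by linarith
  \<comment> \<open>The parallelogram law. Midpoint convexity bounds \<open>(u + w) powr q\<close>
    from above, and superadditivity separates the two summands.\<close>
  have "u + w = ((x\<^sup>2 + y\<^sup>2) + s) / 2"
    by (simp add: u_def w_def s_def power2_eq_square field_simps)
  with powr_midpoint[OF assms(1), of "x\<^sup>2 + y\<^sup>2" s] nonneg(3)
  have 2: "2 * (u + w) powr q \<le> (x\<^sup>2 + y\<^sup>2) powr q + s powr q"
    by (simp only: sum_power2_ge_zero)
  from 1 2 powr_superadditive[OF assms(1) nonneg(1,2)]
  have "s powr q + 2 * (q * s powr (q - 1) * (a * (x + y - 2 * a))) + 2 * w powr q \<le> (x\<^sup>2 + y\<^sup>2) powr q"
    by linarith
  then show ?thesis by (simp add: s_def w_def mult.assoc)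
qed

section \<open>Gluing, energies of densities and admissible competitors\<close>

lemma primitive_iff_Ioc:
  "primitive u w \<longleftrightarrow> w \<in> borel_measurable borel \<and>
     (\<forall>x y. 0 < x \<longrightarrow> x \<le> y \<longrightarrow>
        set_integrable lborel {x<..y} w \<and> u y - u x = (LINT s:{x<..y}|lborel. w s))"
proof -
  have "set_integrable lborel {x<..y} w \<longleftrightarrow> set_integrable lborel {x..y} w"
    "(LINT s:{x<..y}|lborel. w s) = (LINT s:{x..y}|lborel. w s)" for x y
    by (intro set_integrable_discrete_difference[where X = "{x}"]
          set_integral_discrete_difference[where X = "{x}"]; auto)+
  then show ?thesis by (simp add: primitive_def)
qed

text \<open>Half-open intervals tile without overlap, so an interval straddling R is cut there.
  Agreement of the two functions at R makes the increments add up.\<close>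

lemma primitive_glue:
  assumes u1: "primitive u1 w1" and u2: "primitive u2 w2" and eq: "u1 R = u2 R" and "0 < R"
  shows "primitive (\<lambda>r. if r \<le> R then u1 r else u2 r) (\<lambda>r. if r \<le> R then w1 r else w2 r)"
    (is "primitive ?u ?w")
  unfolding primitive_iff_Ioc
proof (intro conjI allI impI)
  show "?w \<in> borel_measurable borel"
    using primitive_borel[OF u1] primitive_borel[OF u2] by measurable
next
  fix x y :: real assume "0 < x" "x \<le> y"
  have below: "set_integrable lborel {s<..t} ?w \<and> ?u t - ?u s = (LINT s:{s<..t}|lborel. ?w s)"
    if "0 < s" "s \<le> t" "t \<le> R" for s t
  proof -
    have "set_integrable lborel {s<..t} ?w \<longleftrightarrow> set_integrable lborel {s<..t} w1"
      "(LINT s:{s<..t}|lborel. ?w s) = (LINT s:{s<..t}|lborel. w1 s)"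
      using that by (intro set_integrable_cong set_lebesgue_integral_cong refl; auto)+
    then show ?thesis using u1 that by (simp add: primitive_iff_Ioc)
  qed
  have above: "set_integrable lborel {s<..t} ?w \<and> ?u t - ?u s = (LINT s:{s<..t}|lborel. ?w s)"
    if "R \<le> s" "s \<le> t" for s t
  proof -
    have "set_integrable lborel {s<..t} ?w \<longleftrightarrow> set_integrable lborel {s<..t} w2"
      "(LINT s:{s<..t}|lborel. ?w s) = (LINT s:{s<..t}|lborel. w2 s)"
      using that by (intro set_integrable_cong set_lebesgue_integral_cong refl; auto)+
    moreover have "?u t = u2 t" "?u s = u2 s"
      using that eq by (cases "t = R"; cases "s = R"; auto)+
    ultimately show ?thesis using u2 that \<open>0 < R\<close> by (simp add: primitive_iff_Ioc)
  qed
  have "set_integrable lborel {x<..y} ?w \<and> ?u y - ?u x = (LINT s:{x<..y}|lborel. ?w s)"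
  proof (cases "y \<le> R \<or> R \<le> x")
    case True
    then show ?thesis using below[of x y] above[of x y] \<open>0 < x\<close> \<open>x \<le> y\<close> by blast
  next
    case False
    then have "{x<..y} = {x<..R} \<union> {R<..y}" "{x<..R} \<inter> {R<..y} = {}" by auto
    with below[of x R] above[of R y] False \<open>0 < x\<close> show ?thesis
      by (auto simp: set_integral_Un intro!: set_integrable_Un)
  qed
  then show "set_integrable lborel {x<..y} ?w" "?u y - ?u x = (LINT s:{x<..y}|lborel. ?w s)" by auto
qed

lemma primitive_linear: "primitive (\<lambda>r. a * r) (\<lambda>_. a)"
  by (rule primitive_C1) (auto intro!: derivative_eq_intros)

lemma primitive_const: "primitive (\<lambda>_. c) (\<lambda>_. 0)"
  by (rule primitive_C1) auto

text \<open>The density is a parameter, so no choice of weak derivative is involved, and the set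
  \<open>A\<close> allows the energy to be split at a radius.\<close>

definition radial_energy :: "real \<Rightarrow> (real \<Rightarrow> real) \<Rightarrow> (real \<Rightarrow> real) \<Rightarrow> real set \<Rightarrow> ennreal" where
  "radial_energy p u w A =
     (\<integral>\<^sup>+ r\<in>A. ennreal ((((w r)\<^sup>2 + (u r)\<^sup>2 / r\<^sup>2) powr (p / 2) + 1 / 2 * (1 - (u r)\<^sup>2)\<^sup>2) * r) \<partial>lborel)"

lemma I_energy_primitive:
  assumes "primitive u w"
  shows "I_energy p u = radial_energy p u w {0<..}"
  unfolding I_energy_def radial_energy_def
  by (rule nn_integral_cong_AE, rule eventually_mono[OF primitive_weak_deriv_AE[OF assms]])
     (auto simp: indicator_def)

lemma X_space_primitive:
  assumes u: "primitive u w" and "0 < p" and fin: "radial_energy p u w {0<..} < \<infinity>"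
  shows "u \<in> X_space p"
proof -
  define D where "D r = ((w r)\<^sup>2 + (u r)\<^sup>2 / r\<^sup>2) powr (p / 2) * r" for r
  have cont: "continuous_on {0<..} u" by (rule primitive_continuous[OF u])
  have "(\<integral>\<^sup>+ r\<in>{0<..}. ennreal (D r) \<partial>lborel) \<le> radial_energy p u w {0<..}"
    unfolding radial_energy_def D_def
    by (intro nn_integral_mono) (auto simp: indicator_def intro!: ennreal_leI mult_right_mono)
  with fin have D_fin: "(\<integral>\<^sup>+ r\<in>{0<..}. ennreal (D r) \<partial>lborel) < \<infinity>"
    by (simp add: order_le_less_trans)
  have "(\<integral>\<^sup>+ r\<in>{0<..}. ennreal ((\<bar>weak_deriv u r\<bar>\<^sup>2 + (u r)\<^sup>2 / r\<^sup>2) powr (p / 2) * r) \<partial>lborel)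
      = (\<integral>\<^sup>+ r\<in>{0<..}. ennreal (D r) \<partial>lborel)"
    unfolding D_def
    by (rule nn_integral_cong_AE, rule eventually_mono[OF primitive_weak_deriv_AE[OF u]])
       (auto simp: indicator_def)
  moreover have "Lp_loc p w"
    unfolding Lp_loc_def
  proof (intro conjI allI impI)
    note [measurable] = primitive_borel[OF u]
    show "set_borel_measurable lborel {0<..} w" by (simp add: set_borel_measurable_def)
    fix a b :: real assume ab: "0 < a" "a < b"
    show "set_integrable lborel {a..b} (\<lambda>r. \<bar>w r\<bar> powr p)"
      unfolding set_integrable_def
    proof (rule integrableI_bounded)
      \<comment> \<open>Away from 0 the weight r is bounded below by a, so the weighted energy
        controls the unweighted p-th power of the density.\<close>
      have le: "\<bar>w r\<bar> powr p \<le> 1 / a * D r" if "a \<le> r" for r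
      proof -
        have "\<bar>w r\<bar> powr p = ((w r)\<^sup>2) powr (p / 2)"
          using powr_powr[of "\<bar>w r\<bar>" 2 "p / 2"] by (cases "w r = 0") simp_all
        also have "\<dots> \<le> ((w r)\<^sup>2 + (u r)\<^sup>2 / r\<^sup>2) powr (p / 2)"
          using \<open>0 < p\<close> by (intro powr_mono2) auto
        also have "\<dots> \<le> \<dots> * (r / a)"
          using that ab mult_left_mono[of 1 "r / a" "((w r)\<^sup>2 + (u r)\<^sup>2 / r\<^sup>2) powr (p / 2)"]
          by simp
        finally show ?thesis by (simp add: D_def mult.commute)
      qed
      have "(\<integral>\<^sup>+ r. ennreal (norm (indicat_real {a..b} r *\<^sub>R \<bar>w r\<bar> powr p)) \<partial>lborel)
          \<le> (\<integral>\<^sup>+ r. ennreal (1 / a) * (ennreal (D r) * indicator {0<..} r) \<partial>lborel)"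
        using le ab
        by (intro nn_integral_mono) (auto simp: indicator_def ennreal_mult'[symmetric] intro!: ennreal_leI)
      also have "\<dots> = ennreal (1 / a) * (\<integral>\<^sup>+ r\<in>{0<..}. ennreal (D r) \<partial>lborel)"
      proof (rule nn_integral_cmult)
        \<comment> \<open>\<open>u\<close> is continuous only on (0,\<infinity>) and arbitrary
          elsewhere, so measurability is proved for its truncation.\<close>
        have [measurable]: "(\<lambda>r. indicator {0<..} r * u r) \<in> borel_measurable borel"
          using borel_measurable_continuous_on_indicator[OF _ cont] by simp
        have "(\<lambda>r. ennreal (((w r)\<^sup>2 + (indicator {0<..} r * u r)\<^sup>2 / r\<^sup>2) powr (p / 2) * r) * indicator {0<..} r)
            \<in> borel_measurable lborel" by measurable
        moreover have "ennreal (((w r)\<^sup>2 + (indicator {0<..} r * u r)\<^sup>2 / r\<^sup>2) powr (p / 2) * r) * indicator {0<..} r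
            = ennreal (D r) * indicator {0<..} r" for r
          by (simp add: D_def indicator_def)
        ultimately show "(\<lambda>r. ennreal (D r) * indicator {0<..} r) \<in> borel_measurable lborel" by simp
      qed
      also have "\<dots> < \<infinity>" using D_fin by (simp add: ennreal_mult_less_top)
      finally show "(\<integral>\<^sup>+ r. ennreal (norm (indicat_real {a..b} r *\<^sub>R \<bar>w r\<bar> powr p)) \<partial>lborel) < \<infinity>" .
    qed measurable
  qed
  ultimately show ?thesis
    using primitive_has_weak_deriv[OF u] Lp_loc_continuous[OF cont \<open>0 < p\<close>] D_fin
    by (auto simp: X_space_def W1p_loc_def)
qed

lemma X_space_weak_deriv:
  assumes "f \<in> X_space p" "continuous_on {0<..} f"
  shows "primitive f (\<lambda>r. indicator {0<..} r * weak_deriv f r)"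
proof -
  have "\<exists>v. has_weak_deriv f v" using assms(1) by (auto simp: X_space_def W1p_loc_def)
  then have "has_weak_deriv f (weak_deriv f)" unfolding weak_deriv_def by (rule someI_ex)
  then show ?thesis using assms(2) by (rule weak_deriv_primitive)
qed

text \<open>The witness is min(r, 1). Past 1 its potential term vanishes and its gradient term is
  r^(1-p), which is integrable at infinity because p > 2. Finiteness of the minimum is what later
  allows tails to be cancelled.\<close>

lemma finite_energy_exists:
  assumes "2 < p"
  shows "\<exists>u w. primitive u w \<and> radial_energy p u w {0<..} < \<infinity>"
proof -
  define u :: "real \<Rightarrow> real" where "u r = (if r \<le> 1 then 1 * r else 1)" for r
  define C where "C = 2 powr (p / 2) + (1 / 2 :: real)"
  define w :: "real \<Rightarrow> real" where "w r = (if r \<le> 1 then 1 else 0)" for r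
  have "primitive u w"
    unfolding u_def[abs_def] w_def[abs_def]
    by (rule primitive_glue[OF primitive_linear primitive_const]) auto
  moreover have "radial_energy p u w {0<..} < \<infinity>"
  proof -
    have "((\<lambda>r. r powr (1 - p)) has_integral - (1 powr (1 - p + 1)) / (1 - p + 1)) {1::real..}"
      using assms by (intro has_integral_powr_to_inf) auto
    then have tail: "(\<integral>\<^sup>+ r. ennreal (indicator {1..} r * r powr (1 - p)) \<partial>lborel) < \<infinity>"
      by (subst nn_integral_has_integral_lebesgue) auto
    have "radial_energy p u w {0<..} \<le> (\<integral>\<^sup>+ r. ennreal C * indicator {0..1} r +
        ennreal (indicator {1..} r * r powr (1 - p)) \<partial>lborel)"
      unfolding radial_energy_def
    proof (intro nn_integral_mono)
      fix r :: real
      show "ennreal ((((w r)\<^sup>2 + (u r)\<^sup>2 / r\<^sup>2) powr (p / 2) + 1 / 2 * (1 - (u r)\<^sup>2)\<^sup>2) * r) * indicator {0<..} r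
          \<le> ennreal C * indicator {0..1} r + ennreal (indicator {1..} r * r powr (1 - p))"
      proof -
        consider "r \<le> 0" | "0 < r" "r \<le> 1" | "1 < r" by linarith
        then show ?thesis
        proof cases
          case 2
          then have "r\<^sup>2 \<le> 1" by (simp add: power_le_one)
          then have "(1 - r\<^sup>2)\<^sup>2 \<le> 1" by (simp add: power_le_one)
          then have "(2 powr (p / 2) + 1 / 2 * (1 - r\<^sup>2)\<^sup>2) * r \<le> C * 1"
            unfolding C_def using 2 by (intro mult_mono add_left_mono) auto
          then have "ennreal ((2 powr (p / 2) + 1 / 2 * (1 - r\<^sup>2)\<^sup>2) * r) \<le> ennreal C"
            by (intro ennreal_leI) simp
          with 2 show ?thesis by (simp add: u_def w_def add_increasing2)
        next
          case 3
          then have "(1 / r\<^sup>2) powr (p / 2) * r = r powr (1 - p)"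
            by (simp add: powr_divide powr_diff powr_powr flip: powr_numeral)
          with 3 show ?thesis by (simp add: u_def w_def)
        qed simp
      qed
    qed
    also have "\<dots> = ennreal C * emeasure lborel {0..1::real} +
        (\<integral>\<^sup>+ r. ennreal (indicator {1..} r * r powr (1 - p)) \<partial>lborel)"
      by (subst nn_integral_add) (auto simp: nn_integral_cmult_indicator)
    also have "\<dots> < \<infinity>" using tail by (simp add: ennreal_mult_less_top)
    finally show ?thesis .
  qed
  ultimately show ?thesis by blast
qed

section \<open>Comparison with the chord\<close>

lemma set_integrable_of_finite_nn_integral:
  fixes h :: "real \<Rightarrow> real"
  assumes "(\<lambda>r. indicator A r * h r) \<in> borel_measurable lborel" "\<And>r. r \<in> A \<Longrightarrow> 0 \<le> h r"
    and "(\<integral>\<^sup>+ r\<in>A. ennreal (h r) \<partial>lborel) < \<infinity>"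
  shows "set_integrable lborel A h"
    and "(\<integral>\<^sup>+ r\<in>A. ennreal (h r) \<partial>lborel) = ennreal (LINT r:A|lborel. h r)"
proof -
  have eq: "ennreal (h r) * indicator A r = ennreal (indicator A r * h r)" for r
    by (simp add: indicator_def)
  have nonneg: "0 \<le> indicator A r * h r" for r
    using assms(2) by (simp add: indicator_def)
  have int: "integrable lborel (\<lambda>r. indicator A r * h r)"
    using assms(1,3) nonneg by (intro integrableI_bounded) (simp_all add: eq)
  then show "set_integrable lborel A h" by (simp add: set_integrable_def)
  show "(\<integral>\<^sup>+ r\<in>A. ennreal (h r) \<partial>lborel) = ennreal (LINT r:A|lborel. h r)"
    using nn_integral_eq_integral[OF int] nonneg by (simp add: eq set_lebesgue_integral_def)
qed

lemma set_integrable_nonneg_bound: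
  fixes g h :: "real \<Rightarrow> real"
  assumes "set_integrable M A g" "h \<in> borel_measurable M" "A \<in> sets M"
    and "\<And>r. r \<in> A \<Longrightarrow> \<bar>h r\<bar> \<le> g r"
  shows "set_integrable M A h"
  using assms(1)
proof (rule set_integrable_bound)
  show "set_borel_measurable M A h"
    using assms(2,3) by (simp add: set_borel_measurable_def)
  show "AE x in M. x \<in> A \<longrightarrow> norm (h x) \<le> norm (g x)"
    using assms(4) by (fastforce intro!: AE_I2)
qed

text \<open>The setting free of weak derivatives: minimality is over all pairs related by
  \<open>primitive\<close>, a condition that is trivial for competitors of infinite energy.\<close>

locale energy_minimizer =
  fixes p :: real and u v :: "real \<Rightarrow> real"
  assumes p: "2 < p"
    and cont: "continuous_on UNIV u"
    and prim: "primitive u v"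
    and nonneg: "\<And>r. 0 \<le> u r"
    and minimal: "\<And>g w. primitive g w \<Longrightarrow> radial_energy p u v {0<..} \<le> radial_energy p g w {0<..}"
begin

definition slope :: "real \<Rightarrow> real" where "slope R = u R / R"

lemma slope_nonneg: "0 < R \<Longrightarrow> 0 \<le> slope R"
  using nonneg by (simp add: slope_def)

lemma u_borel [measurable]: "u \<in> borel_measurable borel"
  using cont by (rule borel_measurable_continuous_onI)

lemma v_borel [measurable]: "v \<in> borel_measurable borel"
  using prim by (rule primitive_borel)

lemma energy_finite: "radial_energy p u v {0<..} < \<infinity>"
  using finite_energy_exists[OF p] minimal by (meson order_le_less_trans)

lemma continuous_integrable:
  fixes h :: "real \<Rightarrow> real"
  assumes "continuous_on UNIV h"
  shows "set_integrable lborel {0<..R} h"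
  by (rule set_integrable_subset[of _ "{0..R}"])
     (auto intro: borel_integrable_atLeastAtMost' continuous_on_subset[OF assms])

lemma radial_energy_split:
  assumes "g \<in> borel_measurable borel" "w \<in> borel_measurable borel" "0 < R"
  shows "radial_energy p g w {0<..} = radial_energy p g w {0<..R} + radial_energy p g w {R<..}"
proof -
  note [measurable] = assms(1,2)
  have *: "h * indicator {0<..} r = h * indicator {0<..R} r + h * indicator {R<..} r" for h :: ennreal and r
    using assms(3) by (auto simp: indicator_def)
  show ?thesis
    unfolding radial_energy_def by (subst *, subst nn_integral_add) auto
qed

text \<open>Apply 2|v| \<le> 1 + v^2, then bound the square by the p-th power through the tangent of
  t^(p/2) at t = 1. The resulting constant is integrable against r dr on a bounded interval.\<close>

lemma v_integrable_near_0:
  assumes "set_integrable lborel {0<..R} (\<lambda>r. ((v r)\<^sup>2 + (u r)\<^sup>2 / r\<^sup>2) powr (p / 2) * r)"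
  shows "set_integrable lborel {0<..R} (\<lambda>r. v r * r)"
proof (rule set_integrable_nonneg_bound)
  show "set_integrable lborel {0<..R} (\<lambda>r. (1 + p / 2) * r + ((v r)\<^sup>2 + (u r)\<^sup>2 / r\<^sup>2) powr (p / 2) * r)"
    by (rule set_integral_add(1)[OF continuous_integrable assms]) (intro continuous_intros)
  fix r assume "r \<in> {0<..R}"
  then have r: "0 < r" by simp
  define t where "t = (v r)\<^sup>2 + (u r)\<^sup>2 / r\<^sup>2"
  have "0 \<le> t" "(v r)\<^sup>2 \<le> t" by (simp_all add: t_def)
  have "1 + p / 2 * (t - 1) \<le> t powr (p / 2)"
    using powr_above_tangent[of "p / 2" 1 t] p \<open>0 \<le> t\<close> by simp
  moreover have "p / 2 * (t - 1) = p / 2 * t - p / 2" by (simp add: right_diff_distrib)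
  moreover have "t \<le> p / 2 * t" using p \<open>0 \<le> t\<close> mult_right_mono[of 1 "p / 2" t] by simp
  moreover have "2 * \<bar>v r\<bar> \<le> 1 + (v r)\<^sup>2"
    using zero_le_power2[of "\<bar>v r\<bar> - 1"] by (simp add: power2_eq_square algebra_simps)
  moreover have "0 \<le> t powr (p / 2)" by simp
  ultimately have "\<bar>v r\<bar> \<le> (1 + p / 2) + t powr (p / 2)"
    using \<open>(v r)\<^sup>2 \<le> t\<close> p by linarith
  then have "\<bar>v r\<bar> * r \<le> ((1 + p / 2) + t powr (p / 2)) * r"
    using r by (intro mult_right_mono) auto
  then show "\<bar>v r * r\<bar> \<le> (1 + p / 2) * r + ((v r)\<^sup>2 + (u r)\<^sup>2 / r\<^sup>2) powr (p / 2) * r"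
    using r by (simp add: abs_mult t_def distrib_right)
qed auto

text \<open>The integrand is the derivative of r u. Integrate from e to R and let e tend to 0: the
  boundary term \<open>u e * e\<close> vanishes by mere continuity of \<open>u\<close> at 0, before
  \<open>u 0 = 0\<close> is known.\<close>

lemma divergence_integral:
  assumes vr: "set_integrable lborel {0<..R} (\<lambda>r. v r * r)" and "0 < R"
  shows "(LINT r:{0<..R}|lborel. v r * r + u r) = R * u R"
proof -
  have int: "set_integrable lborel {0<..R} (\<lambda>r. v r * r + u r)"
    by (intro set_integral_add vr continuous_integrable cont)
  have lim: "((\<lambda>e. LINT r:{e..R}|lborel. v r * r + u r) \<longlongrightarrow> (LINT r:{0<..R}|lborel. v r * r + u r)) (at_right 0)"
    by (rule tendsto_set_lebesgue_integral_at_right) (use int \<open>0 < R\<close> in auto)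
  have id: "primitive (\<lambda>r. r) (\<lambda>_. 1)" using primitive_linear[of 1] by simp
  have "(LINT r:{e..R}|lborel. v r * r + u r) = u R * R - u e * e" if "0 < e" "e < R" for e
    using primitive_integration_by_parts[OF prim id, of e R] that by simp
  then have "\<forall>\<^sub>F e in at_right 0. (LINT r:{e..R}|lborel. v r * r + u r) = u R * R - u e * e"
    using \<open>0 < R\<close> eventually_at_right_less by (auto simp: eventually_at_right_field)
  with lim have "((\<lambda>e. u R * R - u e * e) \<longlongrightarrow> (LINT r:{0<..R}|lborel. v r * r + u r)) (at_right 0)"
    by (rule Lim_transform_eventually)
  moreover have "((\<lambda>e. u R * R - u e * e) \<longlongrightarrow> u R * R - u 0 * 0) (at_right 0)"
  proof -
    have "isCont (\<lambda>e. u R * R - u e * e) 0"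
      using cont by (intro continuous_intros) (auto simp: continuous_on_eq_continuous_at)
    then show ?thesis
      by (simp add: isCont_def filterlim_at_split)
  qed
  ultimately show ?thesis
    using tendsto_unique[OF trivial_limit_at_right_real] by (simp add: mult.commute)
qed

lemma linear_comparison_energy:
  assumes "0 < R"
  shows "radial_energy p u v {0<..R} \<le> radial_energy p (\<lambda>r. slope R * r) (\<lambda>_. slope R) {0<..R}"
proof -
  define g where "g r = (if r \<le> R then slope R * r else u r)" for r
  define w where "w r = (if r \<le> R then slope R else v r)" for r
  have prim_g: "primitive g w"
    unfolding g_def[abs_def] w_def[abs_def]
    by (rule primitive_glue[OF primitive_linear prim]) (use assms in \<open>auto simp: slope_def\<close>)
  have [measurable]: "g \<in> borel_measurable borel" by (simp add: g_def[abs_def])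
  have tail: "radial_energy p g w {R<..} = radial_energy p u v {R<..}"
    unfolding radial_energy_def by (rule nn_integral_cong) (auto simp: g_def w_def indicator_def)
  have head: "radial_energy p g w {0<..R} = radial_energy p (\<lambda>r. slope R * r) (\<lambda>_. slope R) {0<..R}"
    unfolding radial_energy_def by (rule nn_integral_cong) (auto simp: g_def w_def indicator_def)
  have "radial_energy p u v {0<..R} + radial_energy p u v {R<..} \<le>
      radial_energy p g w {0<..R} + radial_energy p g w {R<..}"
    using minimal[OF prim_g] assms primitive_borel[OF prim_g] by (simp add: radial_energy_split)
  \<comment> \<open>Cancelling the common tail in \<open>ennreal\<close> requires it to be
    finite.\<close>
  moreover have "radial_energy p u v {R<..} \<noteq> \<infinity>"
    using energy_finite assms by (auto simp: radial_energy_split[of u v R])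
  ultimately show ?thesis
    unfolding tail head by (metis add.commute ennreal_add_left_cancel_le infinity_ennreal_def)
qed

text \<open>The first-order term integrates to zero: \<open>(v + u / r - 2 a) r\<close> is the derivative of
  \<open>r u - a r\<^sup>2\<close>, which vanishes at \<open>0\<close> and at \<open>R\<close>.\<close>

lemma excess_bound:
  assumes "0 < R"
  defines "a \<equiv> slope R"
  defines "W \<equiv> (\<lambda>r. (((v r - a)\<^sup>2 + (u r / r - a)\<^sup>2) / 4) powr (p / 2) * r)"
  shows "set_integrable lborel {0<..R} W"
    and "2 * (LINT r:{0<..R}|lborel. W r) \<le>
      (LINT r:{0<..R}|lborel. 1 / 2 * ((1 - (a * r)\<^sup>2)\<^sup>2 - (1 - (u r)\<^sup>2)\<^sup>2) * r)"
proof -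
  define q where "q = p / 2"
  define D where "D r = ((v r)\<^sup>2 + (u r)\<^sup>2 / r\<^sup>2) powr q * r" for r
  define P where "P h r = 1 / 2 * (1 - (h r)\<^sup>2)\<^sup>2 * r" for h :: "real \<Rightarrow> real" and r
  \<comment> \<open>\<open>A\<close> and \<open>K\<close> are the value and the slope in
    \<open>norm_powr_above_tangent\<close> at (a, a). \<open>D\<close> and \<open>P\<close> are the
    gradient and potential densities, including the weight r.\<close>
  define A where "A = (2 * a\<^sup>2) powr q"
  define K where "K = 2 * q * (2 * a\<^sup>2) powr (q - 1) * a"
  define l where "l r = a * r" for r
  have a: "0 \<le> a" using assms slope_nonneg by simp
  have q: "1 \<le> q" using p by (simp add: q_def)
  have [measurable]: "D \<in> borel_measurable borel" "W \<in> borel_measurable borel"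
    by (simp_all add: D_def[abs_def] W_def)
  have cont_l: "continuous_on UNIV l" unfolding l_def by (intro continuous_intros)
  then have [measurable]: "l \<in> borel_measurable borel" by (rule borel_measurable_continuous_onI)
  have P_int: "set_integrable lborel {0<..R} (P h)" if "continuous_on UNIV h" for h
    unfolding P_def by (intro continuous_integrable continuous_intros that)
  have P_nonneg: "0 \<le> P h r" if "0 < r" for h r using that by (simp add: P_def)
  have D_nonneg: "0 \<le> D r" if "0 < r" for r using that by (simp add: D_def)
  have energy_u: "radial_energy p u v {0<..R} = (\<integral>\<^sup>+ r\<in>{0<..R}. ennreal (D r + P u r) \<partial>lborel)"
    unfolding radial_energy_def D_def P_def q_def by (simp add: distrib_right)
  have energy_l: "radial_energy p (\<lambda>r. slope R * r) (\<lambda>_. slope R) {0<..R} =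
      (\<integral>\<^sup>+ r\<in>{0<..R}. ennreal (A * r + P l r) \<partial>lborel)"
    unfolding radial_energy_def A_def P_def q_def l_def a_def
    by (intro nn_integral_cong) (auto simp: indicator_def power_mult_distrib distrib_right)
  have l_int: "set_integrable lborel {0<..R} (\<lambda>r. A * r + P l r)"
    by (intro set_integral_add P_int cont_l continuous_integrable continuous_intros)
  have l_nonneg: "0 \<le> A * r + P l r" if "0 < r" for r
    using that P_nonneg by (simp add: A_def)
  have energy_l': "(\<integral>\<^sup>+ r\<in>{0<..R}. ennreal (A * r + P l r) \<partial>lborel) =
      ennreal (LINT r:{0<..R}|lborel. A * r + P l r)"
  proof -
    have "(\<integral>\<^sup>+ r\<in>{0<..R}. ennreal (A * r + P l r) \<partial>lborel) =
        (\<integral>\<^sup>+ r. ennreal (indicator {0<..R} r *\<^sub>R (A * r + P l r)) \<partial>lborel)"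
      by (intro nn_integral_cong) (simp add: indicator_def)
    also have "\<dots> = ennreal (LINT r:{0<..R}|lborel. A * r + P l r)"
      unfolding set_lebesgue_integral_def
      using l_int l_nonneg by (intro nn_integral_eq_integral) (auto simp: set_integrable_def indicator_def)
    finally show ?thesis .
  qed
  have le: "(\<integral>\<^sup>+ r\<in>{0<..R}. ennreal (D r + P u r) \<partial>lborel) \<le> ennreal (LINT r:{0<..R}|lborel. A * r + P l r)"
    using linear_comparison_energy[OF assms(1)] unfolding energy_u energy_l energy_l' .
  have [measurable]: "P u \<in> borel_measurable borel" by (simp add: P_def[abs_def])
  \<comment> \<open>Integrability for \<open>u\<close> is read off from the comparison, since the
    chord has finite energy on (0, R].\<close>
  have u_int: "set_integrable lborel {0<..R} (\<lambda>r. D r + P u r)"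
    and u_eq: "(\<integral>\<^sup>+ r\<in>{0<..R}. ennreal (D r + P u r) \<partial>lborel) = ennreal (LINT r:{0<..R}|lborel. D r + P u r)"
    using le D_nonneg P_nonneg
    by (intro set_integrable_of_finite_nn_integral; force intro: add_nonneg_nonneg order_le_less_trans)+
  have l_int_nonneg: "0 \<le> (LINT r:{0<..R}|lborel. A * r + P l r)"
    unfolding set_lebesgue_integral_def using l_nonneg by (intro integral_nonneg_AE AE_I2) (simp add: indicator_def)
  have D_int: "set_integrable lborel {0<..R} D"
    using u_int by (rule set_integrable_nonneg_bound) (use D_nonneg P_nonneg in auto)
  have "(LINT r:{0<..R}|lborel. D r + P u r) \<le> (LINT r:{0<..R}|lborel. A * r + P l r)"
    using le l_int_nonneg by (simp add: u_eq)
  then have comparison: "(LINT r:{0<..R}|lborel. D r) - (LINT r:{0<..R}|lborel. A * r) \<le>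
      (LINT r:{0<..R}|lborel. P l r) - (LINT r:{0<..R}|lborel. P u r)"
    using D_int P_int[OF cont] P_int[OF cont_l] continuous_integrable[of "\<lambda>r. A * r" R]
    by (simp add: continuous_intros)
  have vr: "set_integrable lborel {0<..R} (\<lambda>r. v r * r)"
    using D_int unfolding D_def q_def by (rule v_integrable_near_0)
  have div_int: "set_integrable lborel {0<..R} (\<lambda>r. (v r * r + u r) - 2 * a * r)"
    by (intro set_integral_add set_integral_diff vr continuous_integrable continuous_intros cont)
  have "(LINT r:{0<..R}|lborel. 2 * a * r) = a * R\<^sup>2"
  proof -
    have "(LINT r:{0<..R}|lborel. 2 * a * r) = (LINT r:{0..R}|lborel. 2 * a * r)"
      by (intro set_integral_discrete_difference[where X = "{0}"]) auto
    also have "\<dots> = a * R\<^sup>2 - a * 0\<^sup>2"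
      unfolding set_lebesgue_integral_def
      using assms(1) by (intro integral_FTC_atLeastAtMost)
        (auto simp: has_real_derivative_iff_has_vector_derivative[symmetric]
              intro!: derivative_eq_intros continuous_intros)
    finally show ?thesis by simp
  qed
  then have div_0: "(LINT r:{0<..R}|lborel. (v r * r + u r) - 2 * a * r) = 0"
    using divergence_integral[OF vr assms(1)] assms(1) vr
    by (simp add: continuous_integrable cont continuous_intros a_def slope_def power2_eq_square)
  have pointwise: "2 * W r \<le> D r - A * r - K * ((v r * r + u r) - 2 * a * r)" if "0 < r" for r
  proof -
    have "(A + K * (v r + u r / r - 2 * a) + 2 * (((v r - a)\<^sup>2 + (u r / r - a)\<^sup>2) / 4) powr q) * r \<le>
        ((v r)\<^sup>2 + (u r / r)\<^sup>2) powr q * r"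
      unfolding A_def K_def using norm_powr_above_tangent[OF q a, of "v r" "u r / r"] that
      by (intro mult_right_mono) auto
    moreover have "(v r + u r / r - 2 * a) * r = (v r * r + u r) - 2 * a * r"
      using that by (simp add: field_simps)
    ultimately show ?thesis
      by (simp add: W_def D_def q_def[symmetric] power_divide distrib_right mult.assoc)
  qed
  have W_nonneg: "0 \<le> W r" if "0 < r" for r using that by (simp add: W_def)
  have rhs_int: "set_integrable lborel {0<..R} (\<lambda>r. D r - A * r - K * ((v r * r + u r) - 2 * a * r))"
    by (intro set_integral_diff set_integrable_mult_right D_int div_int continuous_integrable continuous_intros)
  show W_int: "set_integrable lborel {0<..R} W"
    using rhs_int by (rule set_integrable_nonneg_bound) (use W_nonneg pointwise in force)+
  have "2 * (LINT r:{0<..R}|lborel. W r) = (LINT r:{0<..R}|lborel. 2 * W r)" by simp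
  also have "\<dots> \<le> (LINT r:{0<..R}|lborel. D r - A * r - K * ((v r * r + u r) - 2 * a * r))"
    using W_int rhs_int pointwise by (intro set_integral_mono) auto
  also have "\<dots> = (LINT r:{0<..R}|lborel. D r - A * r) - (LINT r:{0<..R}|lborel. K * ((v r * r + u r) - 2 * a * r))"
    by (intro set_integral_diff set_integrable_mult_right D_int div_int continuous_integrable continuous_intros)
  also have "(LINT r:{0<..R}|lborel. K * ((v r * r + u r) - 2 * a * r)) = 0"
    using div_0 by (simp only: set_integral_mult_right mult_zero_right)
  also have "(LINT r:{0<..R}|lborel. D r - A * r) = (LINT r:{0<..R}|lborel. D r) - (LINT r:{0<..R}|lborel. A * r)"
    by (intro set_integral_diff D_int continuous_integrable continuous_intros)
  also have "\<dots> - 0 \<le> (LINT r:{0<..R}|lborel. P l r) - (LINT r:{0<..R}|lborel. P u r)"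
    using comparison by simp
  also have "\<dots> = (LINT r:{0<..R}|lborel. P l r - P u r)"
    by (intro set_integral_diff(2)[symmetric] P_int cont cont_l)
  also have "(\<lambda>r. P l r - P u r) = (\<lambda>r. 1 / 2 * ((1 - (a * r)\<^sup>2)\<^sup>2 - (1 - (u r)\<^sup>2)\<^sup>2) * r)"
    by (simp add: P_def l_def algebra_simps fun_eq_iff)
  finally show "2 * (LINT r:{0<..R}|lborel. W r) \<le>
      (LINT r:{0<..R}|lborel. 1 / 2 * ((1 - (a * r)\<^sup>2)\<^sup>2 - (1 - (u r)\<^sup>2)\<^sup>2) * r)" .
qed

end

section \<open>Convergence of the slope\<close>

text \<open>Stands in for Hoelder's inequality: below the threshold |z| is at most \<mu>, above it
  |z|^(1-p) is at most \<mu>^(1-p). The threshold is chosen later to balance the two terms.\<close>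

lemma abs_le_powr_threshold:
  fixes z \<mu> p :: real
  assumes "0 < \<mu>" "1 \<le> p"
  shows "\<bar>z\<bar> \<le> \<mu> + \<mu> powr (1 - p) * \<bar>z\<bar> powr p"
proof (cases "\<bar>z\<bar> \<le> \<mu>")
  case True
  then show ?thesis by (simp add: add_increasing2)
next
  case False
  then have pos: "0 < \<bar>z\<bar>" using assms(1) by linarith
  have "\<bar>z\<bar> powr (1 - p) \<le> \<mu> powr (1 - p)"
    using False assms by (intro powr_mono2') auto
  then have "\<bar>z\<bar> powr (1 - p) * \<bar>z\<bar> powr p \<le> \<mu> powr (1 - p) * \<bar>z\<bar> powr p"
    by (intro mult_right_mono) auto
  moreover have "\<bar>z\<bar> powr (1 - p) * \<bar>z\<bar> powr p = \<bar>z\<bar>"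
    using pos by (simp flip: powr_add)
  ultimately show ?thesis using assms(1) by linarith
qed

lemma dyadic_Cauchy_limit:
  fixes h :: "real \<Rightarrow> real"
  assumes "0 < \<delta>" "0 \<le> C"
    and step: "\<And>r R. 0 < R \<Longrightarrow> R \<le> 1 \<Longrightarrow> R / 2 \<le> r \<Longrightarrow> r \<le> R \<Longrightarrow> \<bar>h r - h R\<bar> \<le> C * R powr \<delta>"
  shows "\<exists>L. (h \<longlongrightarrow> L) (at_right 0)"
proof -
  define \<theta> :: real where "\<theta> = (1 / 2) powr \<delta>"
  have "0 < \<theta>" "\<theta> < 1" using assms(1) powr_less_mono2[of \<delta> "1 / 2" 1] by (auto simp: \<theta>_def)
  \<comment> \<open>The sum of the geometric series of errors C \<theta>^k. The fixed-point equation
    K \<theta> + C = K closes the induction on the number \<open>n\<close> of halvings that bring R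
    down to r.\<close>
  define K where "K = C / (1 - \<theta>)"
  have K: "K * \<theta> + C = K" "0 \<le> K" "C \<le> K"
    using \<open>\<theta> < 1\<close> \<open>0 < \<theta>\<close> assms(2) by (auto simp: K_def field_simps)
  have iter: "\<bar>h r - h R\<bar> \<le> K * R powr \<delta>"
    if "0 < r" "r \<le> R" "R \<le> 1" "R \<le> 2 ^ n * r" for n r R
    using that
  proof (induction n arbitrary: R)
    case 0
    then have "r = R" by simp
    then show ?case using K by simp
  next
    case (Suc n)
    show ?case
    proof (cases "R / 2 \<le> r")
      case True
      then have "\<bar>h r - h R\<bar> \<le> C * R powr \<delta>" using Suc.prems by (intro step) auto
      also have "\<dots> \<le> K * R powr \<delta>" using K by (intro mult_right_mono) auto
      finally show ?thesis .
    next
      case False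
      then have "\<bar>h r - h (R / 2)\<bar> \<le> K * (R / 2) powr \<delta>"
        using Suc.prems by (intro Suc.IH) auto
      also have "(R / 2) powr \<delta> = \<theta> * R powr \<delta>"
        using Suc.prems by (simp add: \<theta>_def powr_divide)
      finally have "\<bar>h r - h (R / 2)\<bar> \<le> K * \<theta> * R powr \<delta>" by simp
      moreover have "\<bar>h (R / 2) - h R\<bar> \<le> C * R powr \<delta>"
        using Suc.prems by (intro step) auto
      ultimately have "\<bar>h r - h R\<bar> \<le> (K * \<theta> + C) * R powr \<delta>"
        unfolding distrib_right by linarith
      then show ?thesis using K by simp
    qed
  qed
  have close: "\<bar>h r - h R\<bar> \<le> K * R powr \<delta>" if "0 < r" "r \<le> R" "R \<le> 1" for r R
  proof -
    obtain n where "R / r < 2 ^ n" using real_arch_pow[of 2 "R / r"] by auto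
    then have "R \<le> 2 ^ n * r" using that by (simp add: field_simps)
    with that show ?thesis by (intro iter)
  qed
  have small: "((\<lambda>R. K * R powr \<delta>) \<longlongrightarrow> 0) (at_right 0)"
    using assms(1) by (auto intro!: tendsto_eq_intros eventually_at_right_less simp: eventually_at_filter)
  have "cauchy_filter (filtermap h (at_right 0))"
    unfolding cauchy_filter_metric_filtermap
  proof (intro allI impI)
    fix e :: real assume "e > 0"
    then have "\<forall>\<^sub>F R in at_right 0. K * R powr \<delta> < e / 2"
      using small by (intro order_tendstoD(2)) auto
    then obtain b where b: "b > 0" "\<And>R. 0 < R \<Longrightarrow> R < b \<Longrightarrow> K * R powr \<delta> < e / 2"
      by (auto simp: eventually_at_right_field)
    define R where "R = min (b / 2) 1"
    have R: "0 < R" "R < b" "R \<le> 1" using b(1) by (auto simp: R_def)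
    have near: "\<bar>h r - h R\<bar> < e / 2" if "0 < r" "r < R" for r
      using close[of r R] b(2)[of R] R that by linarith
    show "\<exists>P. eventually P (at_right 0) \<and> (\<forall>x y. P x \<and> P y \<longrightarrow> dist (h x) (h y) < e)"
    proof (intro exI conjI allI impI)
      show "\<forall>\<^sub>F r in at_right 0. 0 < r \<and> r < R"
        using R by (auto simp: eventually_at_right_field)
      fix x y assume "(0 < x \<and> x < R) \<and> 0 < y \<and> y < R"
      then show "dist (h x) (h y) < e"
        using near[of x] near[of y] unfolding dist_real_def by linarith
    qed
  qed
  then obtain L where "filtermap h (at_right 0) \<le> nhds L"
    using complete_UNIV[where 'a = real, unfolded complete_uniform, rule_format, of "filtermap h (at_right 0)"]
    by (auto simp: filtermap_bot_iff)
  then show ?thesis by (auto simp: filterlim_def)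
qed

context energy_minimizer
begin

text \<open>Expanding the squares, only u^2 and (a r)^4 / 2 enter with a positive sign, and a r
  \<le> u(R) \<le> B. The weight and the length of the interval each contribute a factor R.\<close>

lemma excess_integral_bound:
  assumes "0 < R" "0 < B" "\<And>s. 0 < s \<Longrightarrow> s \<le> R \<Longrightarrow> u s \<le> B"
  defines "W \<equiv> (\<lambda>r. (((v r - slope R)\<^sup>2 + (u r / r - slope R)\<^sup>2) / 4) powr (p / 2) * r)"
  shows "(LINT r:{0<..R}|lborel. W r) \<le> (B\<^sup>2 + B ^ 4) * R\<^sup>2"
proof -
  define a where "a = slope R"
  have a: "0 \<le> a" using assms(1) slope_nonneg by (simp add: a_def)
  have int: "set_integrable lborel {0<..R} (\<lambda>r. 1 / 2 * ((1 - (a * r)\<^sup>2)\<^sup>2 - (1 - (u r)\<^sup>2)\<^sup>2) * r)"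
    by (intro continuous_integrable continuous_intros cont)
  have "1 / 2 * ((1 - (a * r)\<^sup>2)\<^sup>2 - (1 - (u r)\<^sup>2)\<^sup>2) * r \<le> (B\<^sup>2 + B ^ 4) * R" if r: "0 < r" "r \<le> R" for r
  proof -
    have "u r \<le> B" using assms(3) r by simp
    then have u: "(u r)\<^sup>2 \<le> B\<^sup>2" using nonneg by (intro power_mono) auto
    have "a * r \<le> a * R" using a r by (intro mult_left_mono) auto
    also have "a * R = u R" using assms(1) by (simp add: a_def slope_def)
    also have "\<dots> \<le> B" using assms(1,3) by simp
    finally have l: "(a * r) ^ 4 \<le> B ^ 4" using a r by (intro power_mono) auto
    have "1 / 2 * ((1 - (a * r)\<^sup>2)\<^sup>2 - (1 - (u r)\<^sup>2)\<^sup>2) =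
        (u r)\<^sup>2 - (a * r)\<^sup>2 - (u r) ^ 4 / 2 + (a * r) ^ 4 / 2"
      by (simp add: power2_eq_square power4_eq_xxxx field_simps)
    also have "\<dots> \<le> B\<^sup>2 + B ^ 4"
    proof -
      have "0 \<le> (a * r)\<^sup>2" "0 \<le> (u r) ^ 4" "0 \<le> B ^ 4" by simp_all
      with u l show ?thesis by linarith
    qed
    finally show ?thesis
      using r by (intro mult_mono) auto
  qed
  then have "(LINT r:{0<..R}|lborel. 1 / 2 * ((1 - (a * r)\<^sup>2)\<^sup>2 - (1 - (u r)\<^sup>2)\<^sup>2) * r) \<le>
      (LINT r:{0<..R}|lborel. (B\<^sup>2 + B ^ 4) * R)"
    by (intro set_integral_mono int continuous_integrable[OF continuous_on_const]) auto
  also have "\<dots> = (B\<^sup>2 + B ^ 4) * R\<^sup>2"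
    using assms(1) by (subst set_integral_const) (auto simp: power2_eq_square)
  finally have "2 * (LINT r:{0<..R}|lborel. W r) \<le> (B\<^sup>2 + B ^ 4) * R\<^sup>2"
    using excess_bound(2)[OF assms(1)] by (simp add: W_def a_def)
  moreover have "0 \<le> (LINT r:{0<..R}|lborel. W r)"
    unfolding set_lebesgue_integral_def W_def
    by (intro integral_nonneg_AE AE_I2) (simp add: indicator_def)
  ultimately show ?thesis by simp
qed

text \<open>Integrate |v - a| over [r, R], bounding it by a threshold plus a multiple of its p-th
  power, which the excess controls. The constant depends on B only through its upper bound M, so B
  may shrink with R without affecting it.\<close>

lemma oscillation_bound:
  assumes "0 < R" "0 < B" "B \<le> M" "\<And>s. 0 < s \<Longrightarrow> s \<le> R \<Longrightarrow> u s \<le> B"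
    and r: "R / 2 \<le> r" "r \<le> R"
  shows "\<bar>u r - slope R * r\<bar> \<le> (1 + 2 * 4 powr (p / 2) * (1 + M\<^sup>2)) * R * B powr (2 / p)"
proof -
  define a where "a = slope R"
  \<comment> \<open>This choice gives \<mu>^(-p) B^2 = 1, so the excess term is also of order R
    \<mu>.\<close>
  define \<mu> where "\<mu> = B powr (2 / p)"
  \<comment> \<open>\<open>4 powr (p / 2)\<close> undoes the division by 4 in \<open>W\<close>;
    \<open>2 / R\<close> pays for the weight, as 1 \<le> 2 s / R for s \<ge> R / 2.\<close>
  define c where "c = \<mu> powr (1 - p) * (4 powr (p / 2) * (2 / R))"
  define W where "W = (\<lambda>r. (((v r - a)\<^sup>2 + (u r / r - a)\<^sup>2) / 4) powr (p / 2) * r)"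
  have mu: "0 < \<mu>" using assms(2) by (simp add: \<mu>_def)
  have "0 < r" using assms(1) r by simp
  have W_int: "set_integrable lborel {0<..R} W"
    using excess_bound(1)[OF assms(1)] by (simp add: W_def a_def)
  have W_bound: "(LINT s:{0<..R}|lborel. W s) \<le> (B\<^sup>2 + B ^ 4) * R\<^sup>2"
    using excess_integral_bound[OF assms(1,2,4)] by (simp add: W_def a_def)
  have W_nonneg: "0 \<le> W s" if "0 < s" for s using that by (simp add: W_def)
  have pointwise: "\<bar>v s - a\<bar> \<le> \<mu> + c * W s" if s: "R / 2 \<le> s" for s
  proof -
    have "0 < s" using s assms(1) by simp
    have "\<bar>v s - a\<bar> powr p = ((v s - a)\<^sup>2) powr (p / 2)"
      using powr_powr[of "\<bar>v s - a\<bar>" 2 "p / 2"] by (cases "v s - a = 0") simp_all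
    also have "\<dots> \<le> ((v s - a)\<^sup>2 + (u s / s - a)\<^sup>2) powr (p / 2)"
      using p by (intro powr_mono2) auto
    also have "\<dots> = 4 powr (p / 2) * (((v s - a)\<^sup>2 + (u s / s - a)\<^sup>2) / 4) powr (p / 2) * 1"
      by (simp add: powr_divide)
    also have "\<dots> \<le> 4 powr (p / 2) * (((v s - a)\<^sup>2 + (u s / s - a)\<^sup>2) / 4) powr (p / 2) * (2 / R * s)"
      using s assms(1) by (intro mult_left_mono) (auto simp: field_simps)
    also have "\<dots> = 4 powr (p / 2) * (2 / R) * W s" by (simp add: W_def)
    finally have "\<mu> powr (1 - p) * \<bar>v s - a\<bar> powr p \<le> \<mu> powr (1 - p) * (4 powr (p / 2) * (2 / R) * W s)"
      by (intro mult_left_mono) auto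
    then show ?thesis
      using abs_le_powr_threshold[OF mu, of p "v s - a"] p by (simp add: c_def mult.assoc)
  qed
  have v_int: "set_integrable lborel {r..R} v" using prim \<open>0 < r\<close> by (rule primitive_integrable)
  have const_int: "set_integrable lborel {r..R} (\<lambda>_. k)" for k :: real
    by (rule borel_integrable_atLeastAtMost') simp
  have diff_int: "set_integrable lborel {r..R} (\<lambda>s. v s - a)"
    using v_int const_int by (rule set_integral_diff)
  have W_int': "set_integrable lborel {r..R} W"
    using W_int by (rule set_integrable_subset) (use \<open>0 < r\<close> in auto)
  have "u R - u r - a * (R - r) = (LINT s:{r..R}|lborel. v s - a)"
    using primitive_diff[OF prim \<open>0 < r\<close> r(2)] v_int const_int[of a] r(2)
    by (simp add: set_integral_const mult.commute)
  also have "\<bar>\<dots>\<bar> \<le> (LINT s:{r..R}|lborel. \<bar>v s - a\<bar>)"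
    using set_integral_norm_bound[OF diff_int] by simp
  also have "\<dots> \<le> (LINT s:{r..R}|lborel. \<mu> + c * W s)"
    using r pointwise by (intro set_integral_mono set_integral_add set_integrable_mult_right
        set_integrable_abs diff_int const_int W_int') auto
  also have "\<dots> = \<mu> * (R - r) + c * (LINT s:{r..R}|lborel. W s)"
    using const_int[of \<mu>] W_int' r(2) by (simp add: set_integral_const mult.commute)
  also have "\<dots> \<le> \<mu> * R + c * ((B\<^sup>2 + B ^ 4) * R\<^sup>2)"
  proof (intro add_mono mult_left_mono)
    have "(LINT s:{r..R}|lborel. W s) \<le> (LINT s:{0<..R}|lborel. W s)"
      unfolding set_lebesgue_integral_def
      using W_int W_int' W_nonneg \<open>0 < r\<close>
      by (intro integral_mono) (auto simp: set_integrable_def indicator_def)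
    with W_bound show "(LINT s:{r..R}|lborel. W s) \<le> (B\<^sup>2 + B ^ 4) * R\<^sup>2" by linarith
  qed (use mu \<open>0 < r\<close> assms(1) in \<open>auto simp: c_def\<close>)
  also have "c * ((B\<^sup>2 + B ^ 4) * R\<^sup>2) = 2 * 4 powr (p / 2) * (1 + B\<^sup>2) * R * \<mu>"
  proof -
    have "\<mu> powr (1 - p) = \<mu> * (\<mu> powr (- p))" using mu by (simp add: powr_diff powr_minus divide_inverse)
    also have "\<mu> powr (- p) = B powr (- 2)" using p by (simp add: \<mu>_def powr_powr)
    also have "\<dots> = 1 / B\<^sup>2" using assms(2) by (simp add: powr_minus_divide)
    finally have "c * ((B\<^sup>2 + B ^ 4) * R\<^sup>2) = \<mu> * (1 / B\<^sup>2) * (4 powr (p / 2) * (2 / R)) * ((B\<^sup>2 + B ^ 4) * R\<^sup>2)"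
      by (simp add: c_def)
    also have "\<dots> = 2 * 4 powr (p / 2) * (1 + B\<^sup>2) * R * \<mu>"
      using assms(1,2) by (simp add: field_simps power2_eq_square power4_eq_xxxx)
    finally show ?thesis .
  qed
  also have "\<mu> * R + 2 * 4 powr (p / 2) * (1 + B\<^sup>2) * R * \<mu> = (1 + 2 * 4 powr (p / 2) * (1 + B\<^sup>2)) * (R * \<mu>)"
    by (simp add: algebra_simps)
  also have "\<dots> \<le> (1 + 2 * 4 powr (p / 2) * (1 + M\<^sup>2)) * (R * \<mu>)"
    using assms(1-3) mu by (intro mult_right_mono add_left_mono mult_left_mono power_mono) auto
  finally have "\<bar>u R - u r - a * (R - r)\<bar> \<le> (1 + 2 * 4 powr (p / 2) * (1 + M\<^sup>2)) * (R * \<mu>)" .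
  moreover have "u R = a * R" using assms(1) by (simp add: a_def slope_def)
  ultimately show ?thesis
    by (simp add: a_def[symmetric] \<mu>_def[symmetric] algebra_simps abs_minus_commute)
qed

text \<open>The oscillation bound with a fixed B gives u(r) \<le> u(2r)/2 + 2 K r. A bound M sqrt(r)
  survives halving with room to spare, since sqrt(2)/2 < 1, and the spare part absorbs the linear
  term; a linear bound would leave no room.\<close>

lemma sqrt_growth: "\<exists>M>0. \<forall>r. 0 < r \<longrightarrow> r \<le> 1 \<longrightarrow> u r \<le> M * sqrt r"
proof -
  have "bounded (u ` {0..1})"
    by (intro compact_imp_bounded compact_continuous_image continuous_on_subset[OF cont]) auto
  then obtain M0 where M0: "\<forall>x\<in>{0..1}. \<bar>u x\<bar> \<le> M0" by (auto simp: bounded_iff)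
  define B where "B = max M0 1"
  have B: "u s \<le> B" if "0 < s" "s \<le> 1" for s
  proof -
    have "\<bar>u s\<bar> \<le> M0" using M0 that by simp
    then show ?thesis by (simp add: B_def)
  qed
  have "0 < B" by (simp add: B_def)
  define K where "K = (1 + 2 * 4 powr (p / 2) * (1 + B\<^sup>2)) * B powr (2 / p)"
  have "0 \<le> K" by (simp add: K_def)
  have half: "u r \<le> u (2 * r) / 2 + 2 * K * r" if "0 < r" "2 * r \<le> 1" for r
  proof -
    have "\<bar>u r - slope (2 * r) * r\<bar> \<le> (1 + 2 * 4 powr (p / 2) * (1 + B\<^sup>2)) * (2 * r) * B powr (2 / p)"
      using that B \<open>0 < B\<close> by (intro oscillation_bound) auto
    moreover have "slope (2 * r) * r = u (2 * r) / 2" using that by (simp add: slope_def)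
    moreover have "(1 + 2 * 4 powr (p / 2) * (1 + B\<^sup>2)) * (2 * r) * B powr (2 / p) = 2 * K * r"
      by (simp add: K_def)
    ultimately show ?thesis by linarith
  qed
  \<comment> \<open>Since sqrt(2) \<le> 3/2, a halving step uses at most 3/4 of M; the remaining
    quarter must cover 2 K, hence 8 K. The summand 2 B covers r > 1/2, where sqrt(r) \<ge>
    1/2.\<close>
  define M where "M = 2 * B + 8 * K"
  have "0 < M" using \<open>0 < B\<close> \<open>0 \<le> K\<close> by (simp add: M_def)
  have "u r \<le> M * sqrt r" if "0 < r" "r \<le> 1" "1 \<le> 2 ^ n * r" for n r
    using that
  proof (induction n arbitrary: r)
    case 0
    then have "r = 1" by simp
    then show ?case using B[of 1] \<open>0 < B\<close> \<open>0 \<le> K\<close> by (simp add: M_def)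
  next
    case (Suc n)
    show ?case
    proof (cases "2 * r \<le> 1")
      case True
      have "u r \<le> u (2 * r) / 2 + 2 * K * r" using Suc.prems True by (intro half)
      also have "u (2 * r) \<le> M * sqrt (2 * r)" using Suc.prems True by (intro Suc.IH) auto
      also have "sqrt (2 * r) = sqrt 2 * sqrt r" by (simp add: real_sqrt_mult)
      also have "M * (sqrt 2 * sqrt r) \<le> M * (3 / 2 * sqrt r)"
        using real_le_lsqrt[of "3 / 2" 2] Suc.prems \<open>0 < M\<close>
        by (intro mult_left_mono mult_right_mono) (auto simp: power2_eq_square)
      also have "2 * K * r \<le> M / 4 * sqrt r"
      proof (rule mult_mono)
        show "r \<le> sqrt r" using Suc.prems by (intro real_le_rsqrt) (simp add: power2_eq_square mult_left_le)
      qed (use Suc.prems \<open>0 < B\<close> \<open>0 \<le> K\<close> in \<open>auto simp: M_def\<close>)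
      finally show ?thesis by simp
    next
      case False
      have "u r \<le> B * 1" using Suc.prems B by simp
      also have "\<dots> \<le> B * (2 * sqrt r)"
        using False \<open>0 < B\<close> real_le_rsqrt[of "1 / 2" r] by (intro mult_left_mono) (auto simp: power2_eq_square)
      also have "\<dots> \<le> M * sqrt r"
        using Suc.prems \<open>0 \<le> K\<close> by (simp add: M_def distrib_right)
      finally show ?thesis .
    qed
  qed
  moreover have "\<exists>n. 1 \<le> 2 ^ n * r" if "0 < r" for r :: real
  proof -
    obtain n where "1 / r < 2 ^ n" using real_arch_pow[of 2 "1 / r"] by auto
    then show ?thesis using that by (intro exI[of _ n]) (simp add: field_simps)
  qed
  ultimately show ?thesis using \<open>0 < M\<close> by blast
qed

text \<open>This boundary value is not part of the definition of a minimizer; it turns the limit of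
  the slope into a derivative at 0.\<close>

lemma u_0: "u 0 = 0"
proof -
  obtain M where M: "\<forall>r. 0 < r \<longrightarrow> r \<le> 1 \<longrightarrow> u r \<le> M * sqrt r" using sqrt_growth by blast
  have "(u \<longlongrightarrow> u 0) (at_right 0)"
    using cont by (auto simp: continuous_on_eq_continuous_at isCont_def filterlim_at_split)
  moreover have "((\<lambda>r. M * sqrt r) \<longlongrightarrow> M * sqrt 0) (at_right 0)"
    by (intro tendsto_intros)
  moreover have "\<forall>\<^sub>F r in at_right 0. u r \<le> M * sqrt r"
    using M by (auto simp: eventually_at_right_field intro!: exI[of _ 1])
  ultimately have "u 0 \<le> M * sqrt 0"
    by (intro tendsto_le[of "at_right 0"]) auto
  with nonneg[of 0] show ?thesis by simp
qed

lemma slope_converges: "\<exists>L. (slope \<longlongrightarrow> L) (at_right 0)"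
proof -
  obtain M where M: "0 < M" "\<forall>r. 0 < r \<longrightarrow> r \<le> 1 \<longrightarrow> u r \<le> M * sqrt r" using sqrt_growth by blast
  define K where "K = 1 + 2 * 4 powr (p / 2) * (1 + M\<^sup>2)"
  have "0 \<le> K" by (simp add: K_def)
  show ?thesis
  proof (rule dyadic_Cauchy_limit)
    show "0 < 1 / p" using p by simp
    show "0 \<le> 2 * K * M powr (2 / p)" using \<open>0 \<le> K\<close> by simp
    fix r R :: real assume R: "0 < R" "R \<le> 1" and r: "R / 2 \<le> r" "r \<le> R"
    have "0 < r" using R r by simp
    \<comment> \<open>The second pass: B is now M sqrt(R). It stays below M because R \<le> 1, so
      \<open>K\<close> is the same at all scales.\<close>
    have "\<bar>u r - slope R * r\<bar> \<le> K * R * (M * sqrt R) powr (2 / p)"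
      unfolding K_def
    proof (rule oscillation_bound[OF R(1) _ _ _ r])
      show "0 < M * sqrt R" using M R by simp
      show "M * sqrt R \<le> M" using M R by (simp add: mult_left_le)
      fix s assume "0 < s" "s \<le> R"
      then have "u s \<le> M * sqrt s" using M R by simp
      also have "\<dots> \<le> M * sqrt R" using \<open>s \<le> R\<close> M by simp
      finally show "u s \<le> M * sqrt R" .
    qed
    also have "(M * sqrt R) powr (2 / p) = M powr (2 / p) * R powr (1 / p)"
      using M R by (simp add: powr_mult powr_powr flip: powr_half_sqrt)
    \<comment> \<open>R \<le> 2 r turns the bound for \<open>u\<close> into one for the slope after
      division by r.\<close>
    also have "K * R * (M powr (2 / p) * R powr (1 / p)) \<le> K * (2 * r) * (M powr (2 / p) * R powr (1 / p))"
      using r \<open>0 \<le> K\<close> by (intro mult_right_mono mult_left_mono) auto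
    finally have "\<bar>u r - slope R * r\<bar> / r \<le> 2 * K * M powr (2 / p) * R powr (1 / p)"
      using \<open>0 < r\<close> by (simp add: field_simps)
    moreover have "slope r - slope R = (u r - slope R * r) / r"
      using \<open>0 < r\<close> by (simp add: slope_def diff_divide_distrib)
    ultimately show "\<bar>slope r - slope R\<bar> \<le> 2 * K * M powr (2 / p) * R powr (1 / p)"
      using \<open>0 < r\<close> by simp
  qed
qed

end

section \<open>Positivity of the limit\<close>

context energy_minimizer
begin

text \<open>The zero function has infinite energy: its potential density alone is r / 2, so the
  interval [1, 1 + n] contributes at least n / 2.\<close>

lemma exists_positive: "\<exists>b>0. 0 < u b"
proof (rule ccontr)
  assume "\<not> ?thesis"
  then have "u r = 0" if "0 < r" for r using nonneg that by (metis less_le)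
  note zero = this
  have "1 / 2 \<le> (((v r)\<^sup>2 + (u r)\<^sup>2 / r\<^sup>2) powr (p / 2) + 1 / 2 * (1 - (u r)\<^sup>2)\<^sup>2) * r" if "1 \<le> r" for r
  proof -
    have "(1 / 2) * 1 \<le> (((v r)\<^sup>2 + (u r)\<^sup>2 / r\<^sup>2) powr (p / 2) + 1 / 2 * (1 - (u r)\<^sup>2)\<^sup>2) * r"
      using that by (intro mult_mono) (auto simp: zero)
    then show ?thesis by simp
  qed
  then have "ennreal (1 / 2) * indicator {1..1 + real n} r \<le>
      ennreal ((((v r)\<^sup>2 + (u r)\<^sup>2 / r\<^sup>2) powr (p / 2) + 1 / 2 * (1 - (u r)\<^sup>2)\<^sup>2) * r) * indicator {0<..} r" for n r
    by (cases "r \<in> {1..1 + real n}") (auto intro!: ennreal_leI simp del: ennreal_half)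
  then have lower: "(\<integral>\<^sup>+ r. ennreal (1 / 2) * indicator {1..1 + real n} r \<partial>lborel) \<le> radial_energy p u v {0<..}" for n
    unfolding radial_energy_def by (intro nn_integral_mono)
  have bound: "ennreal (real n / 2) \<le> radial_energy p u v {0<..}" for n
  proof -
    have "ennreal (real n / 2) = ennreal (1 / 2) * emeasure lborel {1..1 + real n}"
      by (simp flip: ennreal_mult' del: ennreal_half)
    then show ?thesis using lower[of n] by (simp add: nn_integral_cmult_indicator)
  qed
  obtain E where E: "radial_energy p u v {0<..} = ennreal E" "0 \<le> E"
    using energy_finite by (cases "radial_energy p u v {0<..}") auto
  obtain n :: nat where "2 * E < real n" using reals_Archimedean2 by blast
  with bound[of n] E show False by simp
qed

text \<open>If \<open>u\<close> lies below the chord on \<open>(0, b)\<close>, replacing it there by the chord strictly lowers the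
  potential term.\<close>

lemma not_below_chord:
  assumes "0 < b" "u b \<le> 1"
  shows "\<exists>r. 0 < r \<and> r < b \<and> slope b \<le> slope r"
proof (rule ccontr)
  assume "\<not> ?thesis"
  then have below: "slope r < slope b" if "0 < r" "r < b" for r using that by force
  define a where "a = slope b"
  \<comment> \<open>The potential gained by passing to the chord, the negative of the right-hand
    integrand in \<open>excess_bound\<close>.\<close>
  define h where "h r = 1 / 2 * ((1 - (u r)\<^sup>2)\<^sup>2 - (1 - (a * r)\<^sup>2)\<^sup>2) * r" for r
  have h_pos: "0 < h r" if r: "0 < r" "r < b" for r
  proof -
    have "u r < a * r" using below[OF r] r by (simp add: a_def slope_def field_simps)
    moreover have "0 < a" using below[OF r] slope_nonneg[of r] r by (simp add: a_def)
    moreover have "a * r < a * b" using r \<open>0 < a\<close> by simp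
    moreover have "a * b \<le> 1" using assms by (simp add: a_def slope_def)
    moreover have "a * r < 1" using calculation by linarith
    \<comment> \<open>Both values lie in [0, 1), where (1 - x^2)^2 is strictly decreasing.\<close>
    ultimately have "(u r)\<^sup>2 < (a * r)\<^sup>2" "(a * r)\<^sup>2 < 1\<^sup>2"
      using nonneg[of r] r by (intro power_strict_mono; simp)+
    then have "(1 - (a * r)\<^sup>2)\<^sup>2 < (1 - (u r)\<^sup>2)\<^sup>2"
      by (intro power_strict_mono) auto
    with r show ?thesis by (simp add: h_def)
  qed
  have h_int: "set_integrable lborel {0<..b} h"
    unfolding h_def[abs_def] by (intro continuous_integrable continuous_intros cont)
  have "(LINT r:{0<..b}|lborel. 1 / 2 * ((1 - (a * r)\<^sup>2)\<^sup>2 - (1 - (u r)\<^sup>2)\<^sup>2) * r) =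
      (LINT r:{0<..b}|lborel. - h r)"
    by (intro set_lebesgue_integral_cong) (auto simp: h_def algebra_simps)
  also have "\<dots> = - (LINT r:{0<..b}|lborel. h r)"
    using h_int by (rule set_integral_uminus)
  finally have upper: "2 * (LINT r:{0<..b}|lborel. (((v r - a)\<^sup>2 + (u r / r - a)\<^sup>2) / 4) powr (p / 2) * r) \<le>
      - (LINT r:{0<..b}|lborel. h r)"
    using excess_bound(2)[OF assms(1)] by (simp add: a_def)
  have "0 \<le> (LINT r:{0<..b}|lborel. (((v r - a)\<^sup>2 + (u r / r - a)\<^sup>2) / 4) powr (p / 2) * r)"
    unfolding set_lebesgue_integral_def by (intro integral_nonneg_AE AE_I2) (simp add: indicator_def)
  with upper have "(LINT r:{0<..b}|lborel. h r) \<le> 0" by simp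
  \<comment> \<open>At b the curve meets its chord and \<open>h\<close> vanishes; the endpoint is
    dropped to leave only points of strict positivity.\<close>
  moreover have "(LINT r:{0<..b}|lborel. h r) = (LINT r:{0<..<b}|lborel. h r)"
    by (intro set_integral_discrete_difference[where X = "{b}"]) auto
  ultimately have le: "(LINT r:{0<..<b}|lborel. h r) \<le> 0" by simp
  define h0 where "h0 r = indicator {0<..<b} r * h r" for r
  have h0_int: "integrable lborel h0"
  proof -
    have "{0<..<b} \<subseteq> {0<..b}" by auto
    then have "set_integrable lborel {0<..<b} h"
      by (intro set_integrable_subset[OF h_int]) simp_all
    then show ?thesis by (simp add: set_integrable_def h0_def[abs_def])
  qed
  have h0_nonneg: "0 \<le> h0 r" for r using h_pos by (auto simp: h0_def indicator_def less_imp_le)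
  have "integral\<^sup>L lborel h0 = 0"
  proof (rule antisym)
    show "integral\<^sup>L lborel h0 \<le> 0"
      using le by (simp add: set_lebesgue_integral_def h0_def[abs_def])
    show "0 \<le> integral\<^sup>L lborel h0"
      using h0_nonneg by (intro integral_nonneg_AE AE_I2)
  qed
  then have "AE r in lborel. h0 r = 0"
    using integral_nonneg_eq_0_iff_AE[OF h0_int] h0_nonneg by simp
  then have "AE r in lborel. r \<notin> {0<..<b}"
    by eventually_elim (use h_pos in \<open>force simp: h0_def\<close>)
  then have "emeasure lborel {0<..<b} = 0"
    by (subst (asm) AE_iff_measurable[where N = "{0<..<b}"]) auto
  with assms(1) show False by simp
qed

lemma slope_limit_pos:
  assumes "(slope \<longlongrightarrow> L) (at_right 0)"
  shows "0 < L"
proof (rule ccontr)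
  assume "\<not> 0 < L"
  obtain c where c: "0 < c" "0 < u c" using exists_positive by blast
  \<comment> \<open>The first bound forces the slope to reach t no later than c; the second gives t
    r \<le> 1 up to c, as \<open>not_below_chord\<close> requires.\<close>
  define t where "t = min (slope c) (1 / c)"
  have t: "0 < t" "t \<le> slope c" "t * c \<le> 1"
    using c by (auto simp: t_def slope_def min_def field_simps)
  have "\<forall>\<^sub>F r in at_right 0. slope r < t"
    using t(1) \<open>\<not> 0 < L\<close> by (intro order_tendstoD(2)[OF assms]) auto
  then obtain d where d: "0 < d" "\<And>r. 0 < r \<Longrightarrow> r < d \<Longrightarrow> slope r < t"
    by (auto simp: eventually_at_right_field)
  \<comment> \<open>Starting at d > 0 keeps the set compact: the slope is continuous only away from
    0, and on (0, d) it is already below t.\<close>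
  define S where "S = {r \<in> {d..c}. t \<le> slope r}"
  have cont_slope: "continuous_on {0<..} slope"
    unfolding slope_def[abs_def] by (intro continuous_intros continuous_on_subset[OF cont]) auto
  have "continuous_on {d..c} slope"
    using d(1) by (auto intro: continuous_on_subset[OF cont_slope])
  then have "closed S"
    unfolding S_def by (intro continuous_on_closed_Collect_le continuous_on_const) auto
  moreover have "bounded S" by (rule bounded_subset[of "{d..c}"]) (auto simp: S_def)
  ultimately have "compact S" by (simp add: compact_eq_bounded_closed)
  moreover have "c \<in> S"
    using d(2)[of c] c(1) t(2) by (force simp: S_def)
  ultimately obtain b where b: "b \<in> S" "\<And>r. r \<in> S \<Longrightarrow> b \<le> r"
    using compact_attains_inf[of S] by blast
  have "0 < b" "b \<le> c" "t \<le> slope b" using b(1) d(1) by (auto simp: S_def)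
  have before: "slope r < t" if "0 < r" "r < b" for r
    using d(2)[of r] b(2)[of r] that \<open>b \<le> c\<close> by (force simp: S_def)
  \<comment> \<open>The level is not overshot at its first crossing, by left continuity; hence
    \<open>u b\<close> is at most t b.\<close>
  have "slope b \<le> t"
  proof (rule tendsto_upperbound)
    show "(slope \<longlongrightarrow> slope b) (at_left b)"
      using cont_slope \<open>0 < b\<close>
      by (auto simp: continuous_on_eq_continuous_at isCont_def filterlim_at_split)
    show "\<forall>\<^sub>F r in at_left b. slope r \<le> t"
      using before \<open>0 < b\<close> by (auto simp: eventually_at_left_field less_imp_le)
  qed simp
  then have "u b \<le> t * b" using \<open>0 < b\<close> by (simp add: slope_def field_simps)
  also have "\<dots> \<le> t * c" using \<open>b \<le> c\<close> t(1) by (intro mult_left_mono) auto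
  finally have "u b \<le> 1" using t(3) by simp
  then show False
    using not_below_chord[OF \<open>0 < b\<close>] before \<open>t \<le> slope b\<close> by force
qed

end

section \<open>From minimizers over \<open>X_space\<close> to the locale\<close>

lemma nonneg_minimizer_energy_minimizer:
  assumes "p > 2" and f: "nonneg_minimizer p f"
  shows "energy_minimizer p (\<lambda>r. f (max 0 r)) (\<lambda>r. indicator {0<..} r * weak_deriv f r)"
proof -
  \<comment> \<open>Constant extension to the left makes the function continuous and nonnegative on
    the whole line; energies and primitives see only r > 0.\<close>
  define u where "u r = f (max 0 r)" for r
  define v where "v r = indicator {0<..} r * weak_deriv f r" for r
  have X: "f \<in> X_space p" and min: "\<And>g. g \<in> X_space p \<Longrightarrow> I_energy p f \<le> I_energy p g"
    and cont: "continuous_on {0..} f" and nonneg: "\<And>r. 0 \<le> r \<Longrightarrow> 0 \<le> f r"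
    using f by (auto simp: nonneg_minimizer_def is_minimizer_def)
  have "continuous_on {0<..} f" using cont by (rule continuous_on_subset) auto
  with X have prim_f: "primitive f v"
    unfolding v_def[abs_def] by (rule X_space_weak_deriv)
  then have prim_u: "primitive u v" by (simp add: primitive_def u_def)
  have eq: "radial_energy p u v {0<..} = radial_energy p f v {0<..}"
    unfolding radial_energy_def by (rule nn_integral_cong) (auto simp: u_def indicator_def)
  have "energy_minimizer p u v"
  proof
    show "continuous_on UNIV u"
      unfolding u_def by (intro continuous_on_compose2[OF cont] continuous_intros) auto
    show "0 \<le> u r" for r by (simp add: u_def nonneg)
    fix g w assume g: "primitive g w"
    show "radial_energy p u v {0<..} \<le> radial_energy p g w {0<..}"
    proof (cases "radial_energy p g w {0<..} < \<infinity>")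
      case True
      then have "g \<in> X_space p" using g assms(1) by (intro X_space_primitive) auto
      then show ?thesis
        using min[of g] by (simp add: I_energy_primitive[OF prim_f] I_energy_primitive[OF g] eq)
    qed (simp add: less_top[symmetric])
  qed (use assms(1) prim_u in auto)
  then show ?thesis by (simp add: u_def[abs_def] v_def[abs_def])
qed

theorem proposition2p4:
  fixes p :: real and f :: "real \<Rightarrow> real"
  assumes "p > 2"
    and "nonneg_minimizer p f"
  shows "\<exists>L>0. ((\<lambda>r. f r / r) \<longlongrightarrow> L) (at_right 0) \<and>
               (f has_real_derivative L) (at 0 within {0..})"
proof -
  interpret energy_minimizer p "\<lambda>r. f (max 0 r)" "\<lambda>r. indicator {0<..} r * weak_deriv f r"
    using assms by (rule nonneg_minimizer_energy_minimizer)
  obtain L where L: "(slope \<longlongrightarrow> L) (at_right 0)" using slope_converges by blast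
  have "\<forall>\<^sub>F r in at_right 0. slope r = f r / r"
    by (rule eventually_mono[OF eventually_at_right_less]) (simp add: slope_def)
  with L have lim: "((\<lambda>r. f r / r) \<longlongrightarrow> L) (at_right 0)"
    by (rule Lim_transform_eventually)
  \<comment> \<open>Punctured neighbourhoods of 0 in the closed half-line are right neighbourhoods,
    so with \<open>f 0 = 0\<close> the one-sided derivative is the limit of f(r)/r.\<close>
  moreover have "at (0::real) within {0..} = at_right 0"
  proof -
    have "{0..} - {0} = {0<..} - {0::real}" by auto
    then show ?thesis by (simp add: at_within_def)
  qed
  moreover have "f 0 = 0" using u_0 by simp
  ultimately show ?thesis
    using slope_limit_pos[OF L] by (auto simp: has_field_derivative_iff)
qed

end
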